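(* For all integers $n\ge1$, $j\ge0$ and $\vec\beta=(\beta_1,\dots,\beta_{l-1})\in\mathbb{N}^{l-1}$ there is a bijection $\Upsilon: K_0(n,j,\vec\beta)\rightarrow\biguplus_{m=0}^{l-1}X_m$ such that if $\Upsilon(B)=(B',(\omega,b,m))$ then $\mathrm{wt}(B)=\mathrm{wt}(B')\,\mathrm{wt}(\omega)$, and $\vec{\mathrm{col}}(B')=\vec\beta(\hat m)$ if $m\ge1$ while $\vec{\mathrm{col}}(B')=\vec\beta$ if $m=0$.
   Context: Fix $l\ge1$ and indeterminates $x_1,x_2,\dots$. $\mathcal{B}$ is the alphabet of letters $u^m$ ($u\ge1$, $0\le m\le l-1$; $m$-colored) and barred letters $\overline{u^0}$ ($u\ge1$; $0$-colored); each has absolute value $u$ and weight $x_u$. Order $\mathcal{B}$ by $<_B$: all letters $u^a$ with $a\ge1$ come first, ordered by $u^a<_Bv^b$ iff $u<v$ or ($u=v$ and $a<b$); they are followed by the $0$-colored letters in the order $1^0<_B\overline{1^0}<_B2^0<_B\overline{2^0}<_B3^0<_B\cdots$. A colored banner is a word $B=B(1)\cdots B(n)$ over $\mathcal{B}$ such that: if $B(i)$ is barred then $|B(i)|\ge|B(i+1)|$; if $B(i)$ is $0$-colored and unbarred then $|B(i)|\le|B(i+1)|$ or $i=n$; the last letter is unbarred. Its weight is the product of the weights of its letters, and its color vector $\vec{\mathrm{col}}(B)\in\mathbb{N}^{l-1}$ counts, for each $m\ge1$, its $m$-colored letters. A Lyndon word (w.r.t. $<_B$) is a nonempty word strictly lexicographically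 larger than all its other circular rearrangements; every word factors uniquely as a lexicographically weakly increasing sequence of Lyndon words (Lyndon factorization). $K_0(n,j,\vec\beta)$ is the set of colored banners of length $n$ whose Lyndon factorization has no factor consisting of a single $0$-colored letter, with color vector $\vec\beta$ and exactly $j$ barred letters ($K_0(0,0,\vec 0)$ consists of the empty banner). A $0$-colored marked sequence $(\omega,b,0)$ is a weakly increasing sequence $\omega$ of positive integers with an integer $b$, $1\le b<\mathrm{length}(\omega)$; for $m\in[l-1]$, an $m$-colored marked sequence $(\omega,b,m)$ is such an $\omega$ with $0\le b<\mathrm{length}(\omega)$. $M(p,b,m)$ is the set of $m$-colored marked sequences with $\mathrm{length}(\omega)=p$ and mark $b$; $\mathrm{wt}(\omega)=\prod_i x_{\omega_i}$. For $m\in[l-1]$ with $\beta_m>0$, let $\vec\beta(\hat m)=(\beta_1,\dots,\beta_m-1,\dots,\beta_{l-1})$ and $X_m=\biguplus_{0\le i\le n-1,\ j-n+i<k\le j}K_0(i,k,\vec\beta(\hat m))\times M(n-i,j-k,m)$; $X_m=\emptyset$ if $\beta_m=0$. Also $X_0=\biguplus_{0\le i\le n-2,\ j-n+i<k<j}K_0(i,k,\vec\beta)\times M(n-i,j-k,0)$. *)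

theory Defs
  imports Main "HOL-Library.Multiset"
begin

text \<open>A letter of the alphabet B is a triple (u, m, barred): absolute value u,
  colour m, and a flag telling whether it is barred.\<close>
type_synonym letter = "nat \<times> nat \<times> bool"

definition labs :: "letter \<Rightarrow> nat" where "labs c = fst c"
definition lcol :: "letter \<Rightarrow> nat" where "lcol c = fst (snd c)"
definition lbar :: "letter \<Rightarrow> bool" where "lbar c = snd (snd c)"

definition valid_letter :: "nat \<Rightarrow> letter \<Rightarrow> bool" where
  "valid_letter l c \<longleftrightarrow> labs c \<ge> 1 \<and> lcol c < l \<and> (lbar c \<longrightarrow> lcol c = 0)"

definition lessB :: "letter \<Rightarrow> letter \<Rightarrow> bool" where
  "lessB c d \<longleftrightarrow>
     (if lcol c > 0 \<and> lcol d > 0 then labs c < labs d \<or> (labs c = labs d \<and> lcol c < lcol d)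
      else if lcol c > 0 then True
      else if lcol d > 0 then False
      else labs c < labs d \<or> (labs c = labs d \<and> \<not> lbar c \<and> lbar d))"

definition lex_lessB :: "letter list \<Rightarrow> letter list \<Rightarrow> bool" where
  "lex_lessB u v \<longleftrightarrow> (\<exists>p a b u' v'. u = p @ a # u' \<and> v = p @ b # v' \<and> lessB a b)"

definition lyndon :: "letter list \<Rightarrow> bool" where
  "lyndon w \<longleftrightarrow> w \<noteq> [] \<and> (\<forall>k. 0 < k \<and> k < length w \<longrightarrow> lex_lessB (rotate k w) w)"

text \<open>Lexicographic (weak) order on words used for the factorization; for this
  "largest rotation" convention of Lyndon words a proper prefix counts as larger.\<close>
definition word_leB :: "letter list \<Rightarrow> letter list \<Rightarrow> bool" where
  "word_leB u v \<longleftrightarrow> u = v \<or> lex_lessB u v \<or> (\<exists>s. s \<noteq> [] \<and> u = v @ s)"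

definition is_lyndon_fact :: "letter list \<Rightarrow> letter list list \<Rightarrow> bool" where
  "is_lyndon_fact w fs \<longleftrightarrow> concat fs = w \<and> (\<forall>f\<in>set fs. lyndon f) \<and>
     (\<forall>i. Suc i < length fs \<longrightarrow> word_leB (fs ! i) (fs ! Suc i))"

definition lyndon_fact :: "letter list \<Rightarrow> letter list list" where
  "lyndon_fact w = (THE fs. is_lyndon_fact w fs)"

definition banner :: "nat \<Rightarrow> letter list \<Rightarrow> bool" where
  "banner l B \<longleftrightarrow> (\<forall>c\<in>set B. valid_letter l c) \<and>
     (\<forall>i. Suc i < length B \<longrightarrow>
        (lbar (B ! i) \<longrightarrow> labs (B ! i) \<ge> labs (B ! Suc i)) \<and>
        (lcol (B ! i) = 0 \<and> \<not> lbar (B ! i) \<longrightarrow> labs (B ! i) \<le> labs (B ! Suc i))) \<and>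
     (B \<noteq> [] \<longrightarrow> \<not> lbar (last B))"

text \<open>Weight as a monomial in the x_u, represented by the multiset of indices u.\<close>
definition wtB :: "letter list \<Rightarrow> nat multiset" where
  "wtB B = mset (map labs B)"

definition wt_seq :: "nat list \<Rightarrow> nat multiset" where
  "wt_seq \<omega> = mset \<omega>"

definition col_vec :: "nat \<Rightarrow> letter list \<Rightarrow> nat \<Rightarrow> nat" where
  "col_vec l B m = (if 1 \<le> m \<and> m < l then length (filter (\<lambda>c. lcol c = m) B) else 0)"

definition K0 :: "nat \<Rightarrow> nat \<Rightarrow> nat \<Rightarrow> (nat \<Rightarrow> nat) \<Rightarrow> letter list set" where
  "K0 l n j \<beta> = {B. banner l B \<and> length B = n \<and> col_vec l B = \<beta> \<and>
       length (filter lbar B) = j \<and>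
       (\<forall>f\<in>set (lyndon_fact B). \<not> (\<exists>c. f = [c] \<and> lcol c = 0))}"

definition Mseq :: "nat \<Rightarrow> nat \<Rightarrow> nat \<Rightarrow> nat \<Rightarrow> nat list set" where
  "Mseq l p b m = (if (m = 0 \<and> 1 \<le> b \<and> b < p) \<or> (1 \<le> m \<and> m < l \<and> b < p)
      then {\<omega>. length \<omega> = p \<and> sorted \<omega> \<and> (\<forall>x\<in>set \<omega>. 1 \<le> x)} else {})"

definition beta_hat :: "(nat \<Rightarrow> nat) \<Rightarrow> nat \<Rightarrow> nat \<Rightarrow> nat" where
  "beta_hat \<beta> m = \<beta>(m := \<beta> m - 1)"

text \<open>X_m; the disjoint union over (i,k) is represented by pairs, since i = length B'
  and k = number of barred letters of B' are determined by B'.\<close>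
definition Xset :: "nat \<Rightarrow> nat \<Rightarrow> nat \<Rightarrow> (nat \<Rightarrow> nat) \<Rightarrow> nat
                    \<Rightarrow> (letter list \<times> (nat list \<times> nat \<times> nat)) set" where
  "Xset l n j \<beta> m =
    (if m = 0 then
       {(B', (\<omega>, b, 0)) | B' \<omega> b. \<exists>i k. i + 2 \<le> n \<and> j + i < k + n \<and> k < j \<and>
           B' \<in> K0 l i k \<beta> \<and> b = j - k \<and> \<omega> \<in> Mseq l (n - i) (j - k) 0}
     else if \<beta> m = 0 then {}
     else
       {(B', (\<omega>, b, m)) | B' \<omega> b. \<exists>i k. i + 1 \<le> n \<and> j + i < k + n \<and> k \<le> j \<and>
           B' \<in> K0 l i k (beta_hat \<beta> m) \<and> b = j - k \<and> \<omega> \<in> Mseq l (n - i) (j - k) m})"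

end

theory Submission
  imports Defs
begin

text \<open>
  A banner has a Lyndon factor consisting of a single 0-coloured letter c exactly when some
  occurrence of c is a weak left-to-right maximum followed by a larger letter or by the end
  of the word. In a banner such a c is unbarred, and the condition only has to be watched at
  places where an unbarred 0-coloured letter is a weak record.

  Let x be the last letter of B that is barred or has a colour m > 0; the letters after x are
  unbarred, 0-coloured and weakly increasing. Let U be those of absolute value at most |x| and
  V the larger ones, and let D be the longest run of barred letters directly in front of x all
  of which are smaller than the first letter of V. Then B = P D x U V, the word P V is the
  smaller banner, and U, |x| and the reversal of D form the weakly increasing sequence of the
  marked sequence, whose mark is the number of barred letters in D x and whose colour is that
  of x. Conversely, the block D x U is inserted into the final unbarred run of the smaller
  banner, at the place where its first letter fits.

  This fails in one situation: D is empty, x is coloured and P ends in a weak record a, since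
  then P V would end in a forbidden record or have a forbidden rise. Here V is empty, and all
  copies of a at the end of P go into the sequence as well. On the other side this corresponds
  to a block without barred letters whose largest letter in U would become a weak record.
\<close>

section \<open>Lyndon factorization\<close>

lemma append_eq_append_cases:
  assumes "u @ v = s @ t"
  obtains r where "r \<noteq> []" "u = s @ r" "t = r @ v" | r where "s = u @ r" "v = r @ t"
proof -
  from assms obtain r where "u = s @ r \<and> r @ v = t \<or> u @ r = s \<and> v = r @ t"
    by (auto simp: append_eq_append_conv2)
  then show thesis using that by (cases "r = []") auto
qed

section \<open>The order of letters and the strict lexicographic order\<close>

lemma lessB_irrefl [simp]: "\<not> lessB c c"
  by (auto simp: lessB_def)

lemma lessB_trans: "lessB a b \<Longrightarrow> lessB b c \<Longrightarrow> lessB a c"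
  by (auto simp: lessB_def split: if_splits)

text \<open>Validity matters: \<open>lessB\<close> does not see the bar of a letter of positive
  colour, so two invalid letters may be distinct and incomparable.\<close>

lemma lessB_total: "valid_letter l a \<Longrightarrow> valid_letter l b \<Longrightarrow> a \<noteq> b \<Longrightarrow> lessB a b \<or> lessB b a"
  by (cases a; cases b) (auto simp: lessB_def valid_letter_def labs_def lcol_def lbar_def)

lemma lex_lessB_Nil [simp]: "\<not> lex_lessB [] v" "\<not> lex_lessB u []"
  by (auto simp: lex_lessB_def)

lemma lex_lessB_Cons: "lex_lessB (a # u) (b # v) \<longleftrightarrow> lessB a b \<or> a = b \<and> lex_lessB u v"
proof
  assume "lex_lessB (a # u) (b # v)"
  then obtain p c d u' v' where *: "a # u = p @ c # u'" "b # v = p @ d # v'" "lessB c d"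
    by (auto simp: lex_lessB_def)
  then show "lessB a b \<or> a = b \<and> lex_lessB u v"
    unfolding lex_lessB_def by (cases p) (simp, metis append_Cons list.inject)
next
  assume "lessB a b \<or> a = b \<and> lex_lessB u v"
  then show "lex_lessB (a # u) (b # v)"
  proof
    assume "lessB a b"
    then show ?thesis unfolding lex_lessB_def by (metis append_Nil)
  next
    assume "a = b \<and> lex_lessB u v"
    then show ?thesis unfolding lex_lessB_def by (metis append_Cons)
  qed
qed

lemma lex_lessB_irrefl [simp]: "\<not> lex_lessB u u"
  by (induction u) (auto simp: lex_lessB_Cons)

lemma lex_lessB_trans: "lex_lessB u v \<Longrightarrow> lex_lessB v w \<Longrightarrow> lex_lessB u w"
proof (induction u arbitrary: v w)
  case (Cons a u)
  then show ?case
    by (cases v; cases w) (auto simp: lex_lessB_Cons intro: lessB_trans)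
qed auto

lemma lex_lessB_append: "lex_lessB u v \<Longrightarrow> lex_lessB (u @ s) (v @ t)"
  by (auto simp: lex_lessB_def) (metis append.assoc append_Cons)

lemma lex_lessB_same_prefix [simp]: "lex_lessB (p @ u) (p @ v) \<longleftrightarrow> lex_lessB u v"
  by (induction p) (auto simp: lex_lessB_Cons)

lemma lex_lessB_appendD:
  "lex_lessB (u @ s) (v @ t) \<Longrightarrow> length u = length v \<Longrightarrow> lex_lessB u v \<or> u = v \<and> lex_lessB s t"
proof (induction u arbitrary: v)
  case (Cons a u)
  then show ?case by (cases v) (auto simp: lex_lessB_Cons)
qed auto

text \<open>A Lyndon word has no border, so comparing it with its rotations amounts to
  comparing it with its proper suffixes.\<close>

lemma lyndon_iff_suffix:
  "lyndon w \<longleftrightarrow> w \<noteq> [] \<and> (\<forall>u v. w = u @ v \<longrightarrow> u \<noteq> [] \<longrightarrow> v \<noteq> [] \<longrightarrow> lex_lessB v w)"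
proof
  assume w: "lyndon w"
  have rot: "lex_lessB (v @ u) w" if "w = u @ v" "u \<noteq> []" "v \<noteq> []" for u v
    using w that unfolding lyndon_def by (auto dest!: spec[of _ "length u"] simp: rotate_append)
  have "lex_lessB v w" if uv: "w = u @ v" "u \<noteq> []" "v \<noteq> []" for u v
  proof -
    define v' u' where "v' = take (length v) w" and "u' = drop (length v) w"
    have w': "w = v' @ u'" and len: "length v' = length v" "length u' = length u"
      using uv(1) by (auto simp: v'_def u'_def simp del: drop_append take_append)
    have "lex_lessB (v @ u) (v' @ u')" using rot[OF uv] w' by simp
    then consider "lex_lessB v v'" | "v = v'" "lex_lessB u u'"
      using lex_lessB_appendD len by metis
    then show ?thesis
    proof cases
      case 1
      then show ?thesis using lex_lessB_append[of v v' "[]" u'] w' by simp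
    next
      \<comment> \<open>Here \<open>v\<close> is a border of \<open>w\<close>. The rotation starting
        with \<open>v\<close> puts \<open>u\<close> below \<open>u'\<close>, while the one starting
        with \<open>u'\<close> puts \<open>u'\<close> at or below \<open>u\<close>: a
        contradiction.\<close>
      case 2
      have "u' \<noteq> []" using len uv by auto
      moreover have "v' \<noteq> []" using len uv by auto
      ultimately have "lex_lessB (u' @ v') (u @ v)" using rot[OF w'] uv by simp
      then have "lex_lessB u' u \<or> u' = u"
        using lex_lessB_appendD len by metis
      then show ?thesis using 2 lex_lessB_trans lex_lessB_irrefl by metis
    qed
  qed
  then show "w \<noteq> [] \<and> (\<forall>u v. w = u @ v \<longrightarrow> u \<noteq> [] \<longrightarrow> v \<noteq> [] \<longrightarrow> lex_lessB v w)"
    using w by (auto simp: lyndon_def)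
next
  assume *: "w \<noteq> [] \<and> (\<forall>u v. w = u @ v \<longrightarrow> u \<noteq> [] \<longrightarrow> v \<noteq> [] \<longrightarrow> lex_lessB v w)"
  have "lex_lessB (rotate k w) w" if k: "0 < k" "k < length w" for k
  proof -
    have "lex_lessB (drop k w) w"
      using * k by (metis append_take_drop_id drop_eq_Nil leD not_gr_zero take_eq_Nil)
    then show ?thesis
      using lex_lessB_append[of "drop k w" w "take k w" "[]"] k by (simp add: rotate_drop_take)
  qed
  then show "lyndon w" using * by (auto simp: lyndon_def)
qed

lemma lyndon_suffix: "lyndon (u @ v) \<Longrightarrow> u \<noteq> [] \<Longrightarrow> v \<noteq> [] \<Longrightarrow> lex_lessB v (u @ v)"
  by (auto simp: lyndon_iff_suffix)

lemma lyndon_singleton [simp]: "lyndon [c]"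
  by (auto simp: lyndon_def)

lemma lyndon_not_Nil: "lyndon w \<Longrightarrow> w \<noteq> []"
  by (simp add: lyndon_def)

text \<open>The assumption \<open>less\<close> is what \<open>word_leB_total\<close> yields when
  \<open>word_leB u v\<close> fails, so an out-of-order pair of factors can be merged. It serves to
  put \<open>v\<close> below \<open>u @ v\<close>; all other suffixes then follow from those of
  \<open>u\<close> and of \<open>v\<close>.\<close>

lemma lyndon_append:
  assumes "lyndon u" "lyndon v" and less: "lex_lessB v u \<or> (\<exists>s. s \<noteq> [] \<and> v = u @ s)"
  shows "lyndon (u @ v)"
proof -
  have v: "lex_lessB v (u @ v)"
  proof (cases "lex_lessB v u")
    case True
    then show ?thesis using lex_lessB_append[of v u "[]" v] by simp
  next
    case False
    then obtain s where s: "s \<noteq> []" "v = u @ s" using less by auto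
    have "lex_lessB s v" using s assms lyndon_suffix[of u s] lyndon_not_Nil by auto
    then show ?thesis using s(2) by (metis lex_lessB_same_prefix)
  qed
  have "lex_lessB t (u @ v)" if st: "u @ v = s @ t" "s \<noteq> []" "t \<noteq> []" for s t
  proof -
    from st(1) consider r where "r \<noteq> []" "u = s @ r" "t = r @ v" | r where "s = u @ r" "v = r @ t"
      by (rule append_eq_append_cases)
    then show ?thesis
    proof cases
      case 1
      then have "lex_lessB r u" using assms(1) st lyndon_suffix by blast
      then show ?thesis using lex_lessB_append[of r u v v] 1 by simp
    next
      case 2
      show ?thesis
      proof (cases "r = []")
        case True
        then show ?thesis using v 2 by simp
      next
        case False
        then have "lex_lessB t v" using assms(2) st 2 lyndon_suffix by blast
        then show ?thesis using v lex_lessB_trans by blast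
      qed
    qed
  qed
  then show ?thesis using lyndon_not_Nil[OF assms(1)] unfolding lyndon_iff_suffix by auto
qed

section \<open>The weak order on words; existence and uniqueness of the factorization\<close>

lemma word_leB_Nil [simp]: "word_leB u []" "word_leB [] u \<longleftrightarrow> u = []"
  by (auto simp: word_leB_def)

lemma word_leB_Cons:
  "word_leB (a # u) (b # v) \<longleftrightarrow> lessB a b \<or> a = b \<and> word_leB u v"
  by (auto simp: word_leB_def lex_lessB_Cons)

lemma word_leB_trans: "word_leB u v \<Longrightarrow> word_leB v w \<Longrightarrow> word_leB u w"
proof (induction u arbitrary: v w)
  case (Cons a u)
  then show ?case
    by (cases v; cases w) (auto simp: word_leB_Cons intro: lessB_trans)
qed auto

lemma word_leB_total:
  assumes "\<forall>c\<in>set u \<union> set v. valid_letter l c" "\<not> word_leB u v"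
  shows "lex_lessB v u \<or> (\<exists>s. s \<noteq> [] \<and> v = u @ s)"
  using assms
proof (induction u arbitrary: v)
  case Nil
  then show ?case by auto
next
  case (Cons a u)
  show ?case
  proof (cases v)
    case Nil
    then show ?thesis using Cons by auto
  next
    case (Cons b v')
    then show ?thesis
      using Cons.prems Cons.IH[of v'] lessB_total[of l a b]
      by (auto simp: lex_lessB_Cons word_leB_Cons)
  qed
qed

lemma is_lyndon_fact_iff:
  "is_lyndon_fact w fs \<longleftrightarrow> concat fs = w \<and> (\<forall>f\<in>set fs. lyndon f) \<and> sorted_wrt word_leB fs"
  unfolding is_lyndon_fact_def
  by (subst sorted_wrt_iff_nth_Suc_transp)
     (auto simp: transp_def intro: word_leB_trans)

text \<open>Either \<open>f\<close> is small enough to stand in front, or it merges with the first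
  factor into a longer Lyndon word, which is inserted into the rest.\<close>

lemma lyndon_fact_insert:
  assumes "lyndon f" "is_lyndon_fact w fs" "\<forall>c\<in>set (f @ w). valid_letter l c"
  shows "\<exists>gs. is_lyndon_fact (f @ w) gs"
  using assms
proof (induction fs arbitrary: f w)
  case Nil
  then have "is_lyndon_fact (f @ w) [f]" by (auto simp: is_lyndon_fact_iff)
  then show ?case ..
next
  case (Cons g fs)
  show ?case
  proof (cases "word_leB f g")
    case True
    then have "is_lyndon_fact (f @ w) (f # g # fs)"
      using Cons.prems word_leB_trans by (auto simp: is_lyndon_fact_iff)
    then show ?thesis ..
  next
    case False
    have "lyndon (f @ g)"
      using Cons.prems by (intro lyndon_append word_leB_total[OF _ False, of l]) (auto simp: is_lyndon_fact_iff)
    moreover have "is_lyndon_fact (concat fs) fs"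
      using Cons.prems by (auto simp: is_lyndon_fact_iff)
    ultimately have "\<exists>gs. is_lyndon_fact ((f @ g) @ concat fs) gs"
      using Cons.prems by (intro Cons.IH) (auto simp: is_lyndon_fact_iff)
    then show ?thesis using Cons.prems by (auto simp: is_lyndon_fact_iff)
  qed
qed

lemma lyndon_fact_exists:
  "\<forall>c\<in>set w. valid_letter l c \<Longrightarrow> \<exists>fs. is_lyndon_fact w fs"
proof (induction w)
  case Nil
  have "is_lyndon_fact [] []" by (simp add: is_lyndon_fact_def)
  then show ?case ..
next
  case (Cons c w)
  then obtain fs where "is_lyndon_fact w fs" by auto
  then show ?case using lyndon_fact_insert[of "[c]" w fs l] Cons.prems by simp
qed

text \<open>Finds the factor in which \<open>v\<close> starts. Since \<open>q\<close> is nonempty, a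
  cut between two factors is charged to the right one, and \<open>q\<close> shares its first letter
  with \<open>v\<close>.\<close>

lemma concat_eq_appendE:
  assumes "concat fs = u @ v" "v \<noteq> []"
  obtains gs f hs p q where "fs = gs @ f # hs" "f = p @ q" "u = concat gs @ p"
    "v = q @ concat hs" "q \<noteq> []"
proof -
  have "\<exists>gs f hs p q. fs = gs @ f # hs \<and> f = p @ q \<and> u = concat gs @ p
      \<and> v = q @ concat hs \<and> q \<noteq> []"
    using assms
  proof (induction fs arbitrary: u)
    case Nil
    then show ?case by simp
  next
    case (Cons f fs)
    from Cons.prems(1) have "f @ concat fs = u @ v" by simp
    then consider r where "r \<noteq> []" "f = u @ r" "v = r @ concat fs"
      | r where "u = f @ r" "concat fs = r @ v"
      by (rule append_eq_append_cases)
    then show ?case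
    proof cases
      case 1
      then show ?thesis by (metis append_Nil concat.simps(1))
    next
      case 2
      from Cons.IH[OF 2(2) Cons.prems(2)] obtain gs f' hs p q where
        "fs = gs @ f' # hs" "f' = p @ q" "r = concat gs @ p" "v = q @ concat hs" "q \<noteq> []"
        by auto
      then have "f # fs = (f # gs) @ f' # hs \<and> f' = p @ q \<and> u = concat (f # gs) @ p
         \<and> v = q @ concat hs \<and> q \<noteq> []"
        using 2 by simp
      then show ?thesis by blast
    qed
  qed
  then show thesis using that by blast
qed

text \<open>If the first factor of one factorization were longer, it would have a proper suffix
  that is a prefix of a later, hence larger, factor of the other factorization.\<close>

lemma lyndon_fact_hd_not_longer:
  assumes f: "is_lyndon_fact w (f # fs)" and g: "lyndon (f @ r)" "r \<noteq> []"
    and w: "w = (f @ r) @ w'"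
  shows False
proof -
  have "concat fs = r @ w'" using f w by (auto simp: is_lyndon_fact_iff)
  \<comment> \<open>The last letter \<open>x\<close> of \<open>r\<close> selects the factor
    \<open>h\<close> in which \<open>r\<close> ends. The part \<open>t\<close> of \<open>r\<close>
    inside \<open>h\<close> is then both a prefix of \<open>h\<close> and a suffix of
    \<open>f @ r\<close>.\<close>
  then obtain r1 x where r: "r = r1 @ [x]" and "concat fs = r1 @ [x] @ w'"
    using g(2) by (metis append.assoc rev_exhaust)
  then obtain gs h hs p q where h: "fs = gs @ h # hs" "h = p @ q" "r1 = concat gs @ p"
      "[x] @ w' = q @ concat hs" "q \<noteq> []"
    by (metis concat_eq_appendE append_Cons list.discI)
  obtain q' where q: "q = x # q'" using h(4,5) by (cases q) auto
  define t where "t = p @ [x]"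
  have ht: "h = t @ q'" "t \<noteq> []" using h q t_def by auto
  have fh: "word_leB f h" and "f \<noteq> []"
    using f h(1) lyndon_not_Nil by (auto simp: is_lyndon_fact_iff)
  have "f @ r = (f @ concat gs) @ t" using r h(3) t_def by simp
  then have less: "lex_lessB t (f @ r)"
    using lyndon_suffix[of "f @ concat gs" t] g(1) ht \<open>f \<noteq> []\<close> by simp
  \<comment> \<open>As \<open>f\<close> is at most a word starting with \<open>t\<close>, either
    \<open>f\<close> is smaller than \<open>t\<close> at their first difference or one of them is a
    prefix of the other where the comparison would have to be decided.\<close>
  have key: "\<not> lex_lessB t (f @ s)" if "word_leB f (t @ q')" for s
    using that
  proof (induction t arbitrary: f)
    case Nil
    then show ?case by simp
  next
    case (Cons a t)
    then show ?case
      by (cases f) (auto simp: lex_lessB_Cons word_leB_Cons dest: lessB_trans)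
  qed
  show False using key[of r] less fh ht by simp
qed

lemma lyndon_fact_unique:
  "is_lyndon_fact w fs \<Longrightarrow> is_lyndon_fact w gs \<Longrightarrow> fs = gs"
proof (induction fs arbitrary: w gs)
  case Nil
  then have "concat gs = []" "\<forall>g\<in>set gs. g \<noteq> []"
    using lyndon_not_Nil by (auto simp: is_lyndon_fact_iff)
  then show ?case by (cases gs) auto
next
  case (Cons f fs)
  have "f \<noteq> []" "lyndon f" using Cons.prems lyndon_not_Nil by (auto simp: is_lyndon_fact_iff)
  moreover have "concat gs = f @ concat fs" using Cons.prems by (auto simp: is_lyndon_fact_iff)
  ultimately obtain g gs' where gs: "gs = g # gs'" by (cases gs) auto
  have g: "lyndon g" using Cons.prems gs by (auto simp: is_lyndon_fact_iff)
  have w: "w = f @ concat fs" "w = g @ concat gs'"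
    using Cons.prems gs by (auto simp: is_lyndon_fact_iff)
  then consider r where "r \<noteq> []" "f = g @ r" | r where "r \<noteq> []" "g = f @ r" | "f = g"
    by (metis append.right_neutral append_eq_append_conv2)
  then have "f = g"
  proof cases
    case 1
    then show ?thesis
      using lyndon_fact_hd_not_longer[of w g gs' r "concat fs"] Cons.prems(2) gs w(1) \<open>lyndon f\<close>
      by simp
  next
    case 2
    then show ?thesis
      using lyndon_fact_hd_not_longer[of w f fs r "concat gs'"] Cons.prems(1) w(2) g by simp
  qed
  moreover have "fs = gs'"
    using Cons.IH[of "concat fs" gs'] Cons.prems gs w \<open>f = g\<close> by (auto simp: is_lyndon_fact_iff)
  ultimately show ?case using gs by simp
qed

lemma is_lyndon_fact_lyndon_fact:
  assumes "\<forall>c\<in>set w. valid_letter l c"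
  shows "is_lyndon_fact w (lyndon_fact w)"
  unfolding lyndon_fact_def
  using lyndon_fact_exists[OF assms] lyndon_fact_unique by (metis theI)

text \<open>The suffix starting with \<open>c\<close> is at most \<open>f\<close>, which compares
  the two first letters.\<close>

lemma lyndon_le_hd:
  assumes "lyndon f" "c \<in> set f" shows "\<not> lessB (hd f) c"
proof -
  obtain u v where f: "f = u @ c # v" using assms(2) by (meson split_list)
  show ?thesis
  proof (cases u)
    case Nil
    then show ?thesis using f by simp
  next
    case (Cons a u')
    then have "lex_lessB (c # v) (a # u' @ c # v)" using lyndon_suffix[of u "c # v"] assms f by simp
    then have "lessB c a \<or> c = a" by (auto simp: lex_lessB_Cons)
    then show ?thesis using f Cons lessB_trans[of c a c] by auto
  qed
qed

text \<open>Letters of earlier factors are bounded by the first letters of these factors, hence by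
  \<open>c\<close>. This turns a property of the factorization into a condition on \<open>w\<close>
  alone.\<close>

lemma singleton_factor_iff:
  assumes "is_lyndon_fact w fs"
  shows "[c] \<in> set fs \<longleftrightarrow>
    (\<exists>P Q. w = P @ c # Q \<and> (\<forall>d\<in>set P. \<not> lessB c d) \<and> (Q = [] \<or> lessB c (hd Q)))"
proof
  assume "[c] \<in> set fs"
  \<comment> \<open>The last occurrence of \<open>[c]\<close> is taken, so that the next factor
    differs from it.\<close>
  then obtain gs hs where fs: "fs = gs @ [c] # hs" "[c] \<notin> set hs" by (meson split_list_last)
  have "\<not> lessB c d" if d: "d \<in> set (concat gs)" for d
  proof
    assume cd: "lessB c d"
    obtain g where g: "g \<in> set gs" "d \<in> set g" using d by auto
    then have "lyndon g" "word_leB g [c]" using assms fs by (auto simp: is_lyndon_fact_iff sorted_wrt_append)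
    moreover obtain b g' where "g = b # g'" using g(2) by (metis list.set_cases)
    ultimately have "\<not> lessB b d" "lessB b c \<or> b = c"
      using lyndon_le_hd[of g d] g by (auto simp: word_leB_Cons)
    then show False using cd lessB_trans by blast
  qed
  moreover have "concat hs = [] \<or> lessB c (hd (concat hs))"
  proof (cases hs)
    case (Cons h hs')
    \<comment> \<open>A proper prefix counts as larger, so a factor above \<open>[c]\<close> and
      different from it cannot start with \<open>c\<close>.\<close>
    then have h: "lyndon h" "word_leB [c] h" "h \<noteq> [c]"
      using assms fs by (auto simp: is_lyndon_fact_iff sorted_wrt_append)
    then obtain b h' where "h = b # h'" using lyndon_not_Nil by (cases h) auto
    then show ?thesis using h Cons by (auto simp: word_leB_Cons)
  qed simp
  moreover have "w = concat gs @ c # concat hs" using assms fs by (auto simp: is_lyndon_fact_iff)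
  ultimately show "\<exists>P Q. w = P @ c # Q \<and> (\<forall>d\<in>set P. \<not> lessB c d) \<and> (Q = [] \<or> lessB c (hd Q))"
    by blast
next
  assume "\<exists>P Q. w = P @ c # Q \<and> (\<forall>d\<in>set P. \<not> lessB c d) \<and> (Q = [] \<or> lessB c (hd Q))"
  then obtain P Q where w: "w = P @ c # Q" and P: "\<forall>d\<in>set P. \<not> lessB c d"
    and Q: "Q = [] \<or> lessB c (hd Q)" by blast
  have "concat fs = P @ c # Q" using assms w by (auto simp: is_lyndon_fact_iff)
  then obtain gs f hs p q where f: "fs = gs @ f # hs" "f = p @ q" "P = concat gs @ p"
      "c # Q = q @ concat hs" "q \<noteq> []"
    using concat_eq_appendE[of fs P "c # Q"] by blast
  obtain q' where q: "q = c # q'" "Q = q' @ concat hs" using f(4,5) by (cases q) auto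
  have ly: "lyndon f" using assms f by (auto simp: is_lyndon_fact_iff)
  have hd: "\<not> lessB c (hd f)" using P f q by (cases p) auto
  \<comment> \<open>Otherwise \<open>f\<close> contains the letter after \<open>c\<close>, which
    exceeds \<open>c\<close>. The first letter of \<open>f\<close>, which is \<open>c\<close> or
    lies in \<open>P\<close>, would then exceed \<open>c\<close> as well.\<close>
  have "q' = []"
  proof (rule ccontr)
    assume "q' \<noteq> []"
    then have "lessB c (hd q')" "hd q' \<in> set f" using Q q f by auto
    then have "\<not> lessB (hd f) (hd q')" using lyndon_le_hd ly by blast
    moreover have "lex_lessB q' f"
      using lyndon_suffix[of "p @ [c]" q'] ly f q \<open>q' \<noteq> []\<close> by simp
    ultimately have "hd q' = hd f \<or> lessB (hd q') (hd f)"
      using \<open>q' \<noteq> []\<close> lyndon_not_Nil[OF ly] by (cases q'; cases f) (auto simp: lex_lessB_Cons)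
    then show False using \<open>lessB c (hd q')\<close> hd lessB_trans by metis
  qed
  moreover have "p = []"
  proof (rule ccontr)
    assume "p \<noteq> []"
    then have "lex_lessB [c] f" using lyndon_suffix[of p "[c]"] ly f q \<open>q' = []\<close> by simp
    then show False using hd lyndon_not_Nil[OF ly] by (cases f) (auto simp: lex_lessB_Cons)
  qed
  ultimately show "[c] \<in> set fs" using f q by simp
qed

section \<open>Records in banners\<close>

declare split_paired_All [simp del] split_paired_Ex [simp del]

section \<open>Letters of colour 0, domination and weak records\<close>

definition plain :: "letter \<Rightarrow> bool" where
  "plain c \<longleftrightarrow> lcol c = 0 \<and> \<not> lbar c"

definition pl :: "nat \<Rightarrow> letter" where "pl u = (u, 0, False)"
definition br :: "nat \<Rightarrow> letter" where "br u = (u, 0, True)"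

lemma letter_simps [simp]:
  "labs (pl u) = u" "lcol (pl u) = 0" "\<not> lbar (pl u)" "plain (pl u)"
  "labs (br u) = u" "lcol (br u) = 0" "lbar (br u)" "\<not> plain (br u)"
  "labs (u, m, s) = u" "lcol (u, m, s) = m" "lbar (u, m, s) = s"
  by (simp_all add: pl_def br_def labs_def lcol_def lbar_def plain_def)

lemma letter_inject [simp]: "pl u = pl v \<longleftrightarrow> u = v" "br u = br v \<longleftrightarrow> u = v"
  by (simp_all add: pl_def br_def)

lemma plain_eq: "plain c \<Longrightarrow> c = pl (labs c)"
  by (cases c) (auto simp: plain_def pl_def labs_def lcol_def lbar_def)

lemma barred_eq: "valid_letter l c \<Longrightarrow> lbar c \<Longrightarrow> c = br (labs c)"
  by (cases c) (auto simp: valid_letter_def br_def labs_def lcol_def lbar_def)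

lemma map_pl_labs: "\<forall>c\<in>set W. plain c \<Longrightarrow> map pl (map labs W) = W"
  using plain_eq by (induction W) auto

lemma map_br_labs:
  "\<forall>c\<in>set W. valid_letter l c \<Longrightarrow> \<forall>c\<in>set W. lbar c \<Longrightarrow> map br (map labs W) = W"
  using barred_eq by (induction W) auto

lemma lessB_pl [simp]:
  "lessB (pl u) (pl v) \<longleftrightarrow> u < v" "lessB (pl u) (br v) \<longleftrightarrow> u \<le> v"
  by (auto simp: lessB_def)

lemma lessB_pl_colored: "lcol x > 0 \<Longrightarrow> \<not> lessB (pl u) x"
  by (auto simp: lessB_def)

lemma lessB_plD: "lessB (pl u) d \<Longrightarrow> u \<le> labs d"
  by (auto simp: lessB_def split: if_splits)

lemma lessB_pl_mono: "lessB (pl u) d \<Longrightarrow> v \<le> u \<Longrightarrow> lessB (pl v) d"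
  by (auto simp: lessB_def split: if_splits)

text \<open>The negation says that \<open>pl u\<close>, appended to \<open>P\<close>, is a weak
  left-to-right maximum.\<close>

definition dominated :: "letter list \<Rightarrow> nat \<Rightarrow> bool" where
  "dominated P u \<longleftrightarrow> (\<exists>d\<in>set P. lessB (pl u) d)"

lemma dominated_simps [simp]:
  "\<not> dominated [] u"
  "dominated (P @ Q) u \<longleftrightarrow> dominated P u \<or> dominated Q u"
  "dominated (c # Q) u \<longleftrightarrow> lessB (pl u) c \<or> dominated Q u"
  by (auto simp: dominated_def)

lemma dominated_map_pl [simp]: "dominated (map pl W) u \<longleftrightarrow> (\<exists>w\<in>set W. u < w)"
  by (auto simp: dominated_def)

lemma dominated_map_br [simp]: "dominated (map br W) u \<longleftrightarrow> (\<exists>w\<in>set W. u \<le> w)"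
  by (auto simp: dominated_def)

lemma dominated_mono: "dominated P u \<Longrightarrow> v \<le> u \<Longrightarrow> dominated P v"
  unfolding dominated_def using lessB_pl_mono by blast

definition record_end :: "letter list \<Rightarrow> bool" where
  "record_end P \<longleftrightarrow> (\<exists>Q u. P = Q @ [pl u] \<and> \<not> dominated Q u)"

lemma record_end_Nil [simp]: "\<not> record_end []"
  by (simp add: record_end_def)

lemma record_end_snoc [simp]: "record_end (Q @ [pl u]) \<longleftrightarrow> \<not> dominated Q u"
  by (auto simp: record_end_def)

lemma record_end_nonplain: "\<not> plain x \<Longrightarrow> \<not> record_end (Q @ [x])"
  by (auto simp: record_end_def)

definition records_ok :: "letter list \<Rightarrow> bool" where
  "records_ok B \<longleftrightarrow> (\<forall>P c Q. B = P @ c # Q \<longrightarrow> record_end P \<longrightarrow> \<not> lessB (last P) c)"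

lemma records_ok_Nil [simp]: "records_ok []"
  by (simp add: records_ok_def)

lemma records_ok_prefix: "records_ok (P @ Q) \<Longrightarrow> records_ok P"
  by (auto simp: records_ok_def)

lemma records_ok_snoc:
  "records_ok (P @ [c]) \<longleftrightarrow> records_ok P \<and> (record_end P \<longrightarrow> \<not> lessB (last P) c)"
proof
  assume "records_ok (P @ [c])"
  then show "records_ok P \<and> (record_end P \<longrightarrow> \<not> lessB (last P) c)"
    using records_ok_prefix[of P "[c]"] by (auto simp: records_ok_def)
next
  assume *: "records_ok P \<and> (record_end P \<longrightarrow> \<not> lessB (last P) c)"
  show "records_ok (P @ [c])"
    unfolding records_ok_def
  proof (intro allI impI)
    fix P' c' Q
    assume eq: "P @ [c] = P' @ c' # Q" and rec: "record_end P'"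
    show "\<not> lessB (last P') c'"
    proof (cases Q rule: rev_cases)
      case Nil
      then show ?thesis using * eq rec by simp
    next
      case (snoc Q' d)
      then have "P = P' @ c' # Q'" using eq by simp
      then show ?thesis using * rec by (auto simp: records_ok_def)
    qed
  qed
qed

lemma records_ok_no_rise:
  assumes "records_ok (P @ c # Q)" "lessB (last P) c"
  shows "\<not> record_end P"
  using assms by (auto simp: records_ok_def)

text \<open>For banners this is the absence of factors consisting of one 0-coloured letter, see
  \<open>no_singleton_factor_iff\<close>.\<close>

definition good :: "letter list \<Rightarrow> bool" where
  "good B \<longleftrightarrow> records_ok B \<and> \<not> record_end B"

text \<open>The last letter of the sorted run is its largest. If \<open>Q\<close> dominates it, no
  letter of the run is a weak record; otherwise it is a record at the end of the word.\<close>

lemma good_append_plain: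
  assumes "\<not> record_end Q" "sorted W"
  shows "good (Q @ map pl W) \<longleftrightarrow> records_ok Q \<and> (W \<noteq> [] \<longrightarrow> dominated Q (last W))"
proof (cases "W = []")
  case True
  then show ?thesis using assms by (simp add: good_def)
next
  case False
  have "good (Q @ map pl W)" if "records_ok Q" "dominated Q (last W)"
    using False assms(2) that(2)
  proof (induction W rule: rev_nonempty_induct)
    case (single w)
    then show ?case
      using assms that records_ok_snoc by (simp add: good_def)
  next
    case (snoc w W)
    then have "dominated Q (last W)"
      by (auto simp: sorted_append intro: dominated_mono)
    then have "good (Q @ map pl W)" using snoc by (auto simp: sorted_append)
    then show ?case
      using snoc.prems records_ok_snoc[of "Q @ map pl W" "pl w"]
        record_end_snoc[of "Q @ map pl W" w]
      by (auto simp: good_def)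
  qed
  moreover have "dominated Q (last W)" if "good (Q @ map pl W)"
  proof -
    obtain W' w where W: "W = W' @ [w]" using False by (meson rev_exhaust)
    then have "dominated (Q @ map pl W') w"
      using that record_end_snoc[of "Q @ map pl W'" w] by (auto simp: good_def)
    then show ?thesis using W assms(2) by (auto simp: sorted_append)
  qed
  moreover have "records_ok Q" if "good (Q @ map pl W)"
    using that records_ok_prefix by (auto simp: good_def)
  ultimately show ?thesis using False by blast
qed

text \<open>A barred letter never is a forbidden record, so only the first letter of
  \<open>D\<close> matters. If \<open>P\<close> ends in a record, the bound on its last letter makes
  this step a rise.\<close>

lemma records_ok_append_barred:
  assumes "D \<noteq> []" "P \<noteq> [] \<Longrightarrow> plain (last P) \<Longrightarrow> labs (last P) \<le> hd D"
  shows "records_ok (P @ map br D) \<longleftrightarrow> records_ok P \<and> \<not> record_end P"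
  using assms
proof (induction D rule: rev_nonempty_induct)
  case (single d)
  have "lessB (last P) (br d)" if "record_end P"
    using that single by (auto simp: record_end_def)
  then show ?case using records_ok_snoc[of P "br d"] by auto
next
  case (snoc d D)
  then have "\<not> record_end (P @ map br D)"
    using record_end_nonplain[of "br (last D)" "P @ map br (butlast D)"]
    by (metis append.assoc letter_simps(8) append_butlast_last_id list.map(1,2) map_append)
  then show ?case using snoc records_ok_snoc[of "P @ map br D" "br d"] by auto
qed

section \<open>Local banner conditions and maximal suffixes\<close>

definition letter_ok :: "letter \<Rightarrow> letter \<Rightarrow> bool" where
  "letter_ok c d \<longleftrightarrow> (lbar c \<longrightarrow> labs d \<le> labs c) \<and> (plain c \<longrightarrow> labs c \<le> labs d)"

text \<open>Dropping the condition on the last letter makes the notion pass to factors such as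
  \<open>P\<close>, which may end in a barred letter.\<close>

definition prebanner :: "nat \<Rightarrow> letter list \<Rightarrow> bool" where
  "prebanner l B \<longleftrightarrow> (\<forall>c\<in>set B. valid_letter l c) \<and> successively letter_ok B"

lemma banner_iff: "banner l B \<longleftrightarrow> prebanner l B \<and> (B \<noteq> [] \<longrightarrow> \<not> lbar (last B))"
  by (auto simp: banner_def prebanner_def successively_conv_nth letter_ok_def plain_def)

lemma prebanner_append:
  "prebanner l (P @ Q) \<longleftrightarrow>
     prebanner l P \<and> prebanner l Q \<and> (P = [] \<or> Q = [] \<or> letter_ok (last P) (hd Q))"
  by (auto simp: prebanner_def successively_append_iff)

lemma prebanner_Nil [simp]: "prebanner l []"
  by (simp add: prebanner_def)

lemma prebanner_Cons:
  "prebanner l (c # Q) \<longleftrightarrow>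
     valid_letter l c \<and> prebanner l Q \<and> (Q = [] \<or> letter_ok c (hd Q))"
  by (cases Q) (auto simp: prebanner_def)

lemma prebanner_map_pl:
  "prebanner l (map pl W) \<longleftrightarrow> sorted W \<and> (\<forall>w\<in>set W. 1 \<le> w) \<and> (W \<noteq> [] \<longrightarrow> 1 \<le> l)"
proof (induction W)
  case (Cons w W)
  have "(W = [] \<or> w \<le> hd W) \<longleftrightarrow> (\<forall>v\<in>set W. w \<le> v)" if "sorted W"
    using that by (cases W) auto
  then show ?case using Cons
    by (cases "W = []") (auto simp: prebanner_Cons valid_letter_def letter_ok_def hd_map)
qed simp

lemma prebanner_map_br:
  "prebanner l (map br W) \<longleftrightarrow> sorted (rev W) \<and> (\<forall>w\<in>set W. 1 \<le> w) \<and> (W \<noteq> [] \<longrightarrow> 1 \<le> l)"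
proof (induction W)
  case (Cons w W)
  have "(W = [] \<or> hd W \<le> w) \<longleftrightarrow> (\<forall>v\<in>set W. v \<le> w)" if "sorted (rev W)"
    using that by (cases W) (auto simp: sorted_append)
  then show ?case using Cons
    by (cases "W = []") (auto simp: prebanner_Cons valid_letter_def letter_ok_def hd_map sorted_append)
qed simp

lemma max_suffix_exists:
  "\<exists>P W. B = P @ W \<and> (\<forall>c\<in>set W. p c) \<and> (P \<noteq> [] \<longrightarrow> \<not> p (last P))"
proof (intro exI conjI impI)
  show "B = rev (dropWhile p (rev B)) @ rev (takeWhile p (rev B))"
    by (metis rev_append rev_rev_ident takeWhile_dropWhile_id)
  show "\<forall>c\<in>set (rev (takeWhile p (rev B))). p c"
    by (auto dest: set_takeWhileD)
  show "\<not> p (last (rev (dropWhile p (rev B))))" if "rev (dropWhile p (rev B)) \<noteq> []"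
    using that hd_dropWhile[of p "rev B"] by (simp add: last_rev)
qed

text \<open>Both \<open>W\<close> and \<open>W'\<close> are the longest suffix with property
  \<open>p\<close>, obtained by \<open>takeWhile\<close> on the reversed word. The pieces of a split
  word are recovered in this way.\<close>

lemma max_suffix_unique:
  assumes "P @ W = P' @ W'" "\<forall>c\<in>set W. p c" "P \<noteq> [] \<Longrightarrow> \<not> p (last P)"
    "\<forall>c\<in>set W'. p c" "P' \<noteq> [] \<Longrightarrow> \<not> p (last P')"
  shows "P = P'" "W = W'"
proof -
  have W: "rev (takeWhile p (rev (P @ W))) = W"
    if "\<forall>c\<in>set W. p c" "P \<noteq> [] \<Longrightarrow> \<not> p (last P)" for P W
  proof (cases P rule: rev_cases)
    case Nil
    then show ?thesis using that by (simp add: takeWhile_eq_all_conv[THEN iffD2])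
  next
    case (snoc Q c)
    then show ?thesis using that takeWhile_append2[of "rev W" p "rev P"] by simp
  qed
  show "W = W'" using W[of W P] W[of W' P'] assms by metis
  then show "P = P'" using assms(1) by simp
qed

section \<open>Splitting off a block\<close>

text \<open>The list \<open>U @ labs x # rev D\<close> is the sequence of the marked sequence. For
  barred \<open>x\<close> the mark is \<open>length D + 1\<close>, and it is smaller than the length
  of the sequence exactly when \<open>U\<close> is nonempty.\<close>

definition block :: "nat \<Rightarrow> nat list \<Rightarrow> letter \<Rightarrow> nat list \<Rightarrow> bool" where
  "block l D x U \<longleftrightarrow> valid_letter l x \<and> \<not> plain x \<and> sorted (U @ labs x # rev D) \<and>
     (\<forall>u\<in>set U \<union> set D. 1 \<le> u) \<and> (lbar x \<longrightarrow> U \<noteq> [])"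

text \<open>The number \<open>hd (D @ [labs x])\<close> is the absolute value of the first letter of
  the block. The condition on a plain last letter of \<open>P\<close> makes \<open>V\<close> maximal
  in the word without block; the one on a barred last letter makes \<open>D\<close> maximal in the
  word with block.\<close>

definition fits :: "nat \<Rightarrow> letter list \<Rightarrow> nat list \<Rightarrow> letter \<Rightarrow> nat list \<Rightarrow> nat list \<Rightarrow> bool" where
  "fits l P D x U V \<longleftrightarrow> block l D x U \<and> sorted V \<and> (\<forall>v\<in>set V. hd (D @ [labs x]) < v) \<and>
     (P \<noteq> [] \<longrightarrow> plain (last P) \<longrightarrow> labs (last P) \<le> hd (D @ [labs x])) \<and>
     (P \<noteq> [] \<longrightarrow> lbar (last P) \<longrightarrow> V \<noteq> [] \<and> hd V \<le> labs (last P))"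

text \<open>The sequence of a block ends in \<open>hd (D @ [labs x])\<close>, its maximum.\<close>

lemma block_hd:
  assumes "block l D x U"
  shows "labs x \<le> hd (D @ [labs x])" "1 \<le> l" "1 \<le> labs x"
    "u \<in> set U \<Longrightarrow> u \<le> labs x" "u \<in> set U \<Longrightarrow> u \<le> hd (D @ [labs x])" "u \<in> set D \<Longrightarrow> labs x \<le> u"
    "u \<in> set D \<Longrightarrow> u \<le> hd (D @ [labs x])"
  using assms
  by (cases D; fastforce simp: block_def valid_letter_def sorted_append)+

text \<open>The conditions in \<open>fits\<close> settle both the junction of \<open>P\<close> with
  \<open>V\<close> and the last letter. With \<open>banner_with_block\<close> this shows that
  inserting or removing a block keeps the banner property.\<close>

lemma banner_without_block:
  assumes "fits l P D x U V"
  shows "banner l (P @ map pl V) \<longleftrightarrow> prebanner l P"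
proof -
  have "block l D x U" using assms by (simp add: fits_def)
  note b = block_hd[OF this]
  have "prebanner l (map pl V)"
    using assms b(1,2,3) by (fastforce simp: fits_def prebanner_map_pl)
  moreover have "letter_ok (last P) (hd (map pl V))" if "P \<noteq> []" "V \<noteq> []"
    using assms that by (auto simp: fits_def letter_ok_def hd_map dest!: hd_in_set)
  ultimately show ?thesis
    using assms by (cases "V = []") (auto simp: banner_iff prebanner_append fits_def last_map)
qed

lemma banner_with_block:
  assumes "fits l P D x U V"
  shows "banner l (P @ map br D @ x # map pl (U @ V)) \<longleftrightarrow> prebanner l P"
proof -
  have bl: "block l D x U" using assms by (simp add: fits_def)
  note b = block_hd[OF bl]
  have "sorted (U @ V)"
    using assms b(5) by (force simp: fits_def block_def sorted_append)
  moreover have "\<forall>w\<in>set (U @ V). 1 \<le> w"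
    using assms b(1,3) by (fastforce simp: fits_def block_def)
  ultimately have "prebanner l (map pl (U @ V))"
    using b(2) unfolding prebanner_map_pl by simp
  moreover have "letter_ok x (hd (map pl (U @ V)))" if "U @ V \<noteq> []"
    using bl that b(4) by (cases U) (auto simp: block_def letter_ok_def valid_letter_def plain_def)
  ultimately have x: "prebanner l (x # map pl (U @ V))"
    using bl by (auto simp: prebanner_Cons block_def)
  have "prebanner l (map br D)"
    using bl b(2) by (auto simp: prebanner_map_br block_def sorted_append)
  moreover have "letter_ok (last (map br D)) x" if "D \<noteq> []"
    using that b(6)[of "last D"] by (auto simp: letter_ok_def last_map)
  ultimately have "prebanner l (map br D @ x # map pl (U @ V))"
    using x by (auto simp: prebanner_append)
  moreover have "letter_ok (last P) (hd (map br D @ x # map pl (U @ V)))" if "P \<noteq> []"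
  proof -
    have "labs (hd (map br D @ x # map pl (U @ V))) = hd (D @ [labs x])"
      by (cases D) auto
    then show ?thesis
      using assms that by (force simp: fits_def letter_ok_def dest!: hd_in_set)
  qed
  moreover have "\<not> lbar (last (x # map pl (U @ V)))"
    using bl last_map[of "U @ V" pl]
    by (cases "U @ V = []") (auto simp: block_def simp del: map_append)
  ultimately show ?thesis by (auto simp: banner_iff prebanner_append)
qed

section \<open>Records with and without the block\<close>

definition good_banner :: "nat \<Rightarrow> letter list \<Rightarrow> bool" where
  "good_banner l B \<longleftrightarrow> banner l B \<and> good B"

text \<open>If \<open>P\<close> ends in a record, the word is never good: that record is followed by
  a larger letter of \<open>V\<close> or by the end of the word.\<close>

lemma good_banner_without_block:
  assumes "fits l P D x U V"
  shows "good_banner l (P @ map pl V) \<longleftrightarrow>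
    prebanner l P \<and> records_ok P \<and> \<not> record_end P \<and> (V \<noteq> [] \<longrightarrow> dominated P (last V))"
proof (cases "record_end P")
  case False
  then show ?thesis
    using good_append_plain[of P V] banner_without_block[OF assms] assms
    by (auto simp: good_banner_def fits_def)
next
  case True
  have "\<not> good (P @ map pl V)"
  proof (cases V)
    case Nil
    then show ?thesis using True by (simp add: good_def)
  next
    case (Cons v V')
    then have "lessB (last P) (pl v)"
      using True assms by (auto simp: record_end_def fits_def)
    then show ?thesis
      using True Cons records_ok_no_rise[of P "pl v"] by (auto simp: good_def)
  qed
  then show ?thesis using True by (simp add: good_banner_def)
qed

text \<open>The criterion differs from \<open>good_banner_without_block\<close> only for empty
  \<open>D\<close> and coloured \<open>x\<close>. Then \<open>x\<close> lies below every 0-coloured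
  letter, so \<open>P\<close> may end in a record, but the block cannot dominate \<open>U\<close>,
  and for empty \<open>V\<close> this is left to \<open>P\<close>.\<close>

lemma good_banner_with_block:
  assumes "fits l P D x U V"
  shows "good_banner l (P @ map br D @ x # map pl (U @ V)) \<longleftrightarrow>
    prebanner l P \<and> records_ok P \<and> (D \<noteq> [] \<or> lbar x \<longrightarrow> \<not> record_end P) \<and>
    (V \<noteq> [] \<longrightarrow> dominated P (last V)) \<and>
    (V = [] \<and> U \<noteq> [] \<and> D = [] \<and> \<not> lbar x \<longrightarrow> dominated P (last U))"
proof -
  have bl: "block l D x U" using assms by (simp add: fits_def)
  note b = block_hd[OF bl]
  let ?Q = "P @ map br D @ [x]"
  have x: "lbar x \<Longrightarrow> x = br (labs x)" "\<not> lbar x \<Longrightarrow> lcol x > 0" "\<not> plain x"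
    using bl barred_eq[of l x] by (auto simp: block_def plain_def)
  have sorted: "sorted (U @ V)"
    using assms b(5) by (force simp: fits_def block_def sorted_append)
  have P: "labs (last P) \<le> hd (D @ [labs x])" if "P \<noteq> []" "plain (last P)"
    using assms that by (simp add: fits_def)
  have Q: "records_ok ?Q \<longleftrightarrow> records_ok P \<and> (D \<noteq> [] \<or> lbar x \<longrightarrow> \<not> record_end P)"
  proof (cases "lbar x")
    case True
    then have "?Q = P @ map br (D @ [labs x])" using x(1) by simp
    then show ?thesis
      using records_ok_append_barred[of "D @ [labs x]" P] P True by simp
  next
    case False
    have "records_ok ?Q \<longleftrightarrow> records_ok (P @ map br D)"
      using records_ok_snoc[of "P @ map br D" x] lessB_pl_colored[OF x(2)[OF False]]
      by (auto simp: record_end_def)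
    then show ?thesis
      using records_ok_append_barred[of D P] P False by (cases "D = []") auto
  qed
  have rQ: "\<not> record_end ?Q"
    using record_end_nonplain[OF x(3), of "P @ map br D"] by simp
  have "good (?Q @ map pl (U @ V)) \<longleftrightarrow>
    records_ok ?Q \<and> (U @ V \<noteq> [] \<longrightarrow> dominated ?Q (last (U @ V)))"
    using good_append_plain[OF rQ sorted] .
  moreover have "(U @ V \<noteq> [] \<longrightarrow> dominated ?Q (last (U @ V))) \<longleftrightarrow>
    (V \<noteq> [] \<longrightarrow> dominated P (last V)) \<and>
    (V = [] \<and> U \<noteq> [] \<and> D = [] \<and> \<not> lbar x \<longrightarrow> dominated P (last U))"
  proof (cases "V = []")
    \<comment> \<open>The last letter of \<open>V\<close> exceeds the whole block, so only
      \<open>P\<close> can dominate it.\<close>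
    case False
    then have v: "hd (D @ [labs x]) < last V" using assms by (simp add: fits_def)
    have "\<not> lessB (pl (last V)) x" "\<not> dominated (map br D) (last V)"
      using v b(1,7) lessB_plD[of "last V" x] by fastforce+
    then show ?thesis using False by auto
  next
    case True
    have "dominated ?Q (last U)" if "U \<noteq> []" "D \<noteq> []"
      using that b(4)[of "last U"] b(6)[of "hd D"] by (fastforce intro: bexI[of _ "hd D"])
    moreover have "dominated ?Q (last U)" if "U \<noteq> []" "lbar x"
    proof -
      have "lessB (pl (last U)) (br (labs x))" using that b(4)[of "last U"] by simp
      then show ?thesis using x(1) that by simp
    qed
    moreover have "dominated ?Q (last U) \<longleftrightarrow> dominated P (last U)" if "D = []" "\<not> lbar x"
      using that lessB_pl_colored[OF x(2)] by simp
    ultimately show ?thesis using True by auto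
  qed
  ultimately show ?thesis
    using Q banner_with_block[OF assms] by (auto simp: good_banner_def)
qed

text \<open>In the first rule the last premise excludes that the last letter of \<open>U\<close> becomes a weak
  record of the longer word; the second rule treats these blocks.\<close>

inductive splits :: "nat \<Rightarrow> letter list \<Rightarrow> letter list \<Rightarrow> nat list \<Rightarrow> letter \<Rightarrow> nat list \<Rightarrow> bool"
  for l where
  insert: "\<lbrakk>fits l P D x U V; prebanner l P; records_ok P; \<not> record_end P;
      V \<noteq> [] \<longrightarrow> dominated P (last V);
      V = [] \<and> U \<noteq> [] \<and> D = [] \<and> \<not> lbar x \<longrightarrow> dominated P (last U)\<rbrakk>
    \<Longrightarrow> splits l (P @ map br D @ x # map pl (U @ V)) (P @ map pl V) D x U"
| new_record: "\<lbrakk>block l [] x (U @ S); \<not> lbar x; S \<noteq> []; \<forall>s\<in>set S. s = a; good_banner l P;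
      \<not> dominated P a; \<forall>u\<in>set U. u < a\<rbrakk>
    \<Longrightarrow> splits l (P @ map pl S @ x # map pl U) P [] x (U @ S)"

section \<open>Constant runs and properties of the relation \<open>splits\<close>\<close>

lemma last_const: "S \<noteq> [] \<Longrightarrow> \<forall>s\<in>set S. s = a \<Longrightarrow> last S = a"
  using last_in_set by blast

lemma sorted_const: "\<forall>s\<in>set S. s = a \<Longrightarrow> sorted S"
  by (induction S) auto

lemma const_list_snoc:
  assumes "S \<noteq> []" "\<forall>s\<in>set S. s = a"
  obtains S' where "S = S' @ [a]" "\<forall>s\<in>set S'. s = a"
  using assms by (cases S rule: rev_cases) auto

text \<open>Makes the copies of \<open>pl a\<close> appended to \<open>P\<close> a maximal run, so
  that they can be read off.\<close>

lemma last_ne_record: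
  assumes "good_banner l P" "\<not> dominated P a" "P \<noteq> []"
  shows "last P \<noteq> pl a"
proof
  assume "last P = pl a"
  then obtain Q where "P = Q @ [pl a]" using assms(3) by (metis append_butlast_last_id)
  then show False using assms by (simp add: good_banner_def good_def)
qed

lemma record_end_append_const:
  assumes "S \<noteq> []" "\<forall>s\<in>set S. s = a" "\<not> dominated P a"
  shows "record_end (P @ map pl S)"
proof -
  obtain S' where "S = S' @ [a]" "\<forall>s\<in>set S'. s = a" using assms const_list_snoc by metis
  then show ?thesis using assms(3) record_end_snoc[of "P @ map pl S'" a] by simp
qed

text \<open>The longer word of \<open>new_record\<close> also has the shape required by
  \<open>fits\<close>, with the copies of \<open>a\<close> at the end of \<open>P\<close> and with
  empty \<open>V\<close>. So both rules can be compared by \<open>fits_unique\<close>.\<close>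

lemma fits_record:
  assumes "block l [] x (U @ S)" "\<not> lbar x" "S \<noteq> []" "\<forall>s\<in>set S. s = a"
  shows "fits l (P @ map pl S) [] x U []"
proof -
  have "a \<le> labs x" using block_hd(4)[OF assms(1), of a] assms(3,4)
    by (metis UnCI list.set_cases list.set_intros(1) neq_Nil_conv set_append)
  moreover have "last S = a" using assms last_const by metis
  ultimately show ?thesis
    using assms by (auto simp: fits_def block_def sorted_append last_map)
qed

lemma splits_good_banner:
  assumes "splits l B B' D x U"
  shows "good_banner l B"
  using assms
proof cases
  case (insert P V)
  then show ?thesis using good_banner_with_block[of l P D x U V] by simp
next
  case (new_record U' S a)
  have f: "fits l (B' @ map pl S) [] x U' []"
    using new_record fits_record by blast
  have P: "prebanner l B'" "records_ok B'" "\<not> record_end B'"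
    using new_record by (auto simp: good_banner_def good_def banner_iff)
  have S: "1 \<le> a" "1 \<le> l"
    using block_hd(2)[OF new_record(4)] new_record(4,6,7) by (auto simp: block_def neq_Nil_conv)
  have "letter_ok (last B') (pl a)" if "B' \<noteq> []"
  proof -
    \<comment> \<open>A larger plain letter would dominate \<open>a\<close>.\<close>
    have "labs (last B') \<le> a" if "plain (last B')"
    proof (rule ccontr)
      assume "\<not> ?thesis"
      then have "lessB (pl a) (last B')" by (subst plain_eq[OF that]) simp
      then show False using \<open>B' \<noteq> []\<close> new_record(9) by (auto simp: dominated_def)
    qed
    then show ?thesis
      using that new_record(8) by (auto simp: letter_ok_def good_banner_def banner_iff)
  qed
  moreover have "hd S = a" "sorted S"
    using new_record(6,7) sorted_const by auto
  moreover have "prebanner l (map pl S)"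
    using S new_record(7) \<open>sorted S\<close> by (auto simp: prebanner_map_pl)
  ultimately have pre: "prebanner l (B' @ map pl S)"
    using P(1) new_record(6) by (auto simp: prebanner_append hd_map)
  have "records_ok (B' @ map pl S)"
    using new_record(6,7)
  proof (induction S rule: rev_nonempty_induct)
    case (single s)
    then show ?case using P records_ok_snoc by simp
  next
    case (snoc s S)
    then have "last (B' @ map pl S) = pl s" by (simp add: last_map last_const)
    moreover have "records_ok (B' @ map pl S)" using snoc by simp
    ultimately show ?case using records_ok_snoc[of "B' @ map pl S" "pl s"] by simp
  qed
  \<comment> \<open>The copies of \<open>a\<close> dominate \<open>U'\<close>, as the criterion
    demands for empty \<open>V\<close>.\<close>
  moreover have "last U' < last S" if "U' \<noteq> []"
    using that new_record(10) last_const[OF new_record(6,7)] by simp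
  ultimately show ?thesis
    using good_banner_with_block[OF f] pre new_record(1,2,5,6) by auto
qed

lemma splits_target:
  assumes "splits l B B' D x U"
  shows "good_banner l B'" "block l D x U"
  using assms
proof (atomize (full), cases)
  case (insert P V)
  then show "good_banner l B' \<and> block l D x U"
    using good_banner_without_block[OF insert(3)] by (simp add: fits_def)
qed simp

lemma splits_mset:
  assumes "splits l B B' D x U"
  shows "mset B = mset (B' @ map br D @ x # map pl U)"
  using assms by cases auto

text \<open>The word is cut from the right: first the plain run after \<open>x\<close>, then
  \<open>U\<close> and \<open>V\<close> by comparison with \<open>labs x\<close>, then
  \<open>D\<close>. The rule depends on whether the remaining \<open>P\<close> ends in a
  record.\<close>

lemma splits_total:
  assumes B: "good_banner l B" "B \<noteq> []"
  shows "\<exists>B' D x U. splits l B B' D x U"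
proof -
  have pre: "prebanner l B" and good: "good B"
    using B by (auto simp: good_banner_def banner_iff)
  obtain Qx W' where QW: "B = Qx @ W'" "\<forall>c\<in>set W'. plain c" "Qx \<noteq> [] \<longrightarrow> \<not> plain (last Qx)"
    using max_suffix_exists[of B plain] by blast
  define W where "W = map labs W'"
  have W: "W' = map pl W" using QW map_pl_labs W_def by simp
  then have sW: "sorted W" "\<forall>w\<in>set W. 1 \<le> w"
    using pre QW by (auto simp: prebanner_append prebanner_map_pl)
  \<comment> \<open>In a nonempty sorted word of plain letters the last one is a record at the
    end.\<close>
  have "Qx \<noteq> []"
  proof
    assume "Qx = []"
    then show False using good_append_plain[of "[]" W] sW good QW W B by simp
  qed
  then obtain Q x where Qx: "Qx = Q @ [x]" "\<not> plain x" using QW(3) by (metis append_butlast_last_id)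
  then have rQx: "\<not> record_end Qx" using record_end_nonplain by simp
  then have dom: "records_ok Qx" "W \<noteq> [] \<longrightarrow> dominated Qx (last W)"
    using good_append_plain[OF rQx sW(1)] good QW W by auto
  have vx: "valid_letter l x" using pre QW Qx by (auto simp: prebanner_def)
  define U where "U = takeWhile (\<lambda>u. u \<le> labs x) W"
  define V where "V = dropWhile (\<lambda>u. u \<le> labs x) W"
  have WUV: "W = U @ V" by (simp add: U_def V_def)
  have U: "\<forall>u\<in>set U. u \<le> labs x" by (auto simp: U_def dest: set_takeWhileD)
  have V: "V \<noteq> [] \<Longrightarrow> labs x < hd V"
    using hd_dropWhile[of "\<lambda>u. u \<le> labs x" W] by (auto simp: V_def)
  \<comment> \<open>For empty \<open>V\<close> the bound disappears and every barred letter
    qualifies.\<close>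
  obtain P D' where PD: "Q = P @ D'" "\<forall>c\<in>set D'. lbar c \<and> (V = [] \<or> labs c < hd V)"
      "P \<noteq> [] \<longrightarrow> \<not> (lbar (last P) \<and> (V = [] \<or> labs (last P) < hd V))"
    using max_suffix_exists[of Q "\<lambda>c. lbar c \<and> (V = [] \<or> labs c < hd V)"] by blast
  define D where "D = map labs D'"
  have preP: "prebanner l (P @ D' @ x # map pl W)" using pre QW Qx PD W by simp
  have D: "D' = map br D"
    using preP PD map_br_labs[of D' l] by (auto simp: D_def prebanner_def)
  have Beq: "B = P @ map br D @ x # map pl (U @ V)" using QW Qx PD D W WUV by simp
  have bl: "block l D x U"
  proof -
    have "sorted (rev D)" "\<forall>d\<in>set D. 1 \<le> d"
      using preP D by (auto simp: prebanner_append prebanner_map_br)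
    moreover have "labs x \<le> last D" if "D \<noteq> []"
      using preP D that by (auto simp: prebanner_append letter_ok_def last_map)
    then have "\<forall>d\<in>set D. labs x \<le> d" using \<open>sorted (rev D)\<close>
      by (cases D rule: rev_cases) (auto intro: order_trans)
    moreover from this have "\<forall>u\<in>set U. \<forall>d\<in>set D. u \<le> d"
      using U order_trans by blast
    moreover have "U \<noteq> []" if "lbar x"
    proof -
      have "W \<noteq> []" using that B QW Qx W by (auto simp: good_banner_def banner_iff)
      moreover have "labs (hd (map pl W)) \<le> labs x" if "W \<noteq> []"
        using preP \<open>lbar x\<close> that by (auto simp: prebanner_append prebanner_Cons letter_ok_def)
      ultimately show ?thesis by (cases W) (auto simp: U_def)
    qed
    ultimately show ?thesis
      using U sW WUV vx Qx(2) by (auto simp: block_def sorted_append)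
  qed
  have hdV: "hd (D @ [labs x]) < hd V" if "V \<noteq> []"
    using PD(2) that V D by (cases D) auto
  have Vm: "\<forall>v\<in>set V. hd (D @ [labs x]) < v"
    using hdV sW(1) WUV by (cases V) (auto simp: sorted_append)
  have hdD: "labs (hd (map br D @ x # map pl (U @ V))) = hd (D @ [labs x])" by (cases D) auto
  have Pok: "letter_ok (last P) (hd (map br D @ x # map pl (U @ V)))" if "P \<noteq> []"
    using preP D that WUV by (auto simp: prebanner_append)
  have fits: "fits l P D x U V"
    using bl sW(1) WUV Vm PD(3) Pok hdD by (auto simp: fits_def letter_ok_def sorted_append)
  have conds: "prebanner l P" "records_ok P" "D \<noteq> [] \<or> lbar x \<longrightarrow> \<not> record_end P"
      "V \<noteq> [] \<longrightarrow> dominated P (last V)"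
      "V = [] \<and> U \<noteq> [] \<and> D = [] \<and> \<not> lbar x \<longrightarrow> dominated P (last U)"
    using good_banner_with_block[OF fits] B(1) Beq by auto
  show ?thesis
  proof (cases "record_end P")
    case False
    then show ?thesis using splits.insert[OF fits] conds Beq by auto
  next
    case True
    then have Dx: "D = []" "\<not> lbar x" using conds by auto
    obtain P1 a where P1: "P = P1 @ [pl a]" "\<not> dominated P1 a" using True by (auto simp: record_end_def)
    \<comment> \<open>The last letter of \<open>V\<close> exceeds \<open>a\<close>, so whatever in
      \<open>P\<close> dominates it lies in \<open>P1\<close> and would dominate \<open>a\<close>
      too.\<close>
    have "V = []"
    proof (rule ccontr)
      assume "V \<noteq> []"
      then have "a < hd V" "dominated P (last V)"
        using fits Vm P1 conds(4) by (auto simp: fits_def intro: le_less_trans)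
      moreover have "hd V \<le> last V" using sW WUV \<open>V \<noteq> []\<close> by (cases V) (auto simp: sorted_append)
      ultimately show False using P1 dominated_mono[of P1 "last V" a] by auto
    qed
    obtain P0 S' where S': "P = P0 @ S'" "\<forall>c\<in>set S'. c = pl a" "P0 \<noteq> [] \<longrightarrow> last P0 \<noteq> pl a"
      using max_suffix_exists[of P "\<lambda>c. c = pl a"] by blast
    define S where "S = map labs S'"
    have S: "S' = map pl S" "\<forall>s\<in>set S. s = a"
    proof -
      have "\<forall>c\<in>set S'. plain c" using S'(2) by auto
      then show "S' = map pl S" using map_pl_labs unfolding S_def by metis
      show "\<forall>s\<in>set S. s = a" using S'(2) by (auto simp: S_def)
    qed
    have "S \<noteq> []" using S' S P1 by auto
    then obtain S2 where S2: "S = S2 @ [a]" using S(2) const_list_snoc by metis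
    have P1eq: "P1 = P0 @ map pl S2" using P1 S'(1) S(1) S2 by simp
    have nd: "\<not> dominated P0 a" using P1 P1eq by simp
    have preP0: "prebanner l P0" and ok: "P0 \<noteq> [] \<Longrightarrow> letter_ok (last P0) (pl a)"
      using conds(1) S' S \<open>S \<noteq> []\<close> by (auto simp: prebanner_append hd_map)
    have "hd S = a" using S(2) \<open>S \<noteq> []\<close> by simp
    have nb: "P0 \<noteq> [] \<Longrightarrow> \<not> lbar (last P0)"
    proof
      assume P0: "P0 \<noteq> []" "lbar (last P0)"
      then have "last P0 = br (labs (last P0))"
        using preP0 by (auto simp: prebanner_def intro: barred_eq)
      moreover have "a \<le> labs (last P0)" using ok P0 by (simp add: letter_ok_def)
      ultimately have "lessB (pl a) (last P0)" by (metis lessB_pl(2))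
      then show False using nd P0 by (auto simp: dominated_def)
    qed
    \<comment> \<open>By maximality of the run, a record at the end of \<open>P0\<close> is smaller
      than \<open>a\<close> and would be followed by a rise.\<close>
    have "\<not> record_end P0"
    proof (cases "P0 = []")
      case False
      obtain S3 where S3: "S = a # S3" using \<open>hd S = a\<close> \<open>S \<noteq> []\<close> by (metis list.collapse)
      then have ro: "records_ok (P0 @ pl a # map pl S3)"
        using conds(2) unfolding S'(1) S(1) S3 by simp
      have "lessB (last P0) (pl a)" if "record_end P0"
      proof -
        obtain v where v: "last P0 = pl v" using \<open>record_end P0\<close> by (auto simp: record_end_def)
        then have "v \<le> a" using ok False by (simp add: letter_ok_def)
        then show ?thesis using v S'(3) False by auto
      qed
      then show ?thesis using records_ok_no_rise[OF ro] by blast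
    qed simp
    moreover have "records_ok P0" using conds(2) S' records_ok_prefix by simp
    ultimately have gP0: "good_banner l P0"
      using preP0 nb by (simp add: good_banner_def good_def banner_iff)
    \<comment> \<open>\<open>P\<close> dominates the last letter of \<open>U\<close>, but
      \<open>P1\<close> does not dominate \<open>a\<close>; so that letter, the largest of
      \<open>U\<close>, is below \<open>a\<close>.\<close>
    have Ua: "\<forall>u\<in>set U. u < a"
    proof (cases "U = []")
      case False
      then have "dominated P (last U)" using conds(5) Dx \<open>V = []\<close> by simp
      then have "last U < a"
        using P1 dominated_mono[of P1 "last U" a] by (metis dominated_simps lessB_pl(1) linorder_not_le)
      moreover have "\<forall>u\<in>set U. u \<le> last U"
        using sW(1) WUV False by (cases U rule: rev_cases) (auto simp: sorted_append)
      ultimately show ?thesis by auto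
    qed simp
    have "a \<le> labs x" using fits P1 Dx by (simp add: fits_def)
    moreover have "1 \<le> a" using conds(1) P1 by (auto simp: prebanner_def valid_letter_def)
    moreover have "sorted S" using S(2) sorted_const by blast
    ultimately have "block l [] x (U @ S)"
      using bl Dx Ua S(2) by (auto simp: block_def sorted_append less_imp_le)
    then have "splits l (P0 @ map pl S @ x # map pl U) P0 [] x (U @ S)"
      using Dx \<open>S \<noteq> []\<close> S(2) gP0 nd Ua by (intro splits.new_record) auto
    then show ?thesis using Beq S' S Dx \<open>V = []\<close> by auto
  qed
qed

text \<open>The case distinction selects the rule: \<open>new_record\<close> is taken when the
  largest letter of \<open>U\<close> would be an undominated record. Domination is tested in all of
  \<open>B'\<close>, which equals \<open>P\<close> when \<open>V\<close> is empty.\<close>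

lemma splits_onto:
  assumes B': "good_banner l B'" and bl: "block l D x U"
  shows "\<exists>B. splits l B B' D x U"
proof (cases "D = [] \<and> \<not> lbar x \<and> U \<noteq> [] \<and> \<not> dominated B' (last U)")
  case True
  define a where "a = last U"
  \<comment> \<open>\<open>S\<close> collects all copies of the largest letter of
    \<open>U\<close>.\<close>
  obtain U' S where U: "U = U' @ S" "\<forall>u\<in>set S. u = a" "U' \<noteq> [] \<longrightarrow> last U' \<noteq> a"
    using max_suffix_exists[of U "\<lambda>u. u = a"] by blast
  have S: "S \<noteq> []"
  proof
    assume "S = []"
    then have "U' = U" using U(1) by simp
    then show False using U(3) True by (simp add: a_def)
  qed
  have bl': "block l [] x (U' @ S)" using bl True U(1) by simp
  have "\<forall>u\<in>set U'. u < a"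
  proof (cases U' rule: rev_cases)
    case (snoc W w)
    have "sorted (U' @ S)" "a \<in> set S"
      using bl' last_const[OF S U(2)] last_in_set[OF S] by (auto simp: block_def sorted_append)
    then have "w < a" "\<forall>u\<in>set W. u \<le> w" using U(3) snoc by (auto simp: sorted_append)
    then show ?thesis using snoc by auto
  qed simp
  then have "splits l (B' @ map pl S @ x # map pl U') B' [] x (U' @ S)"
    using True bl' U(2) S B' by (intro splits.new_record) (auto simp: a_def)
  then show ?thesis using True U(1) by auto
next
  case False
  note b = block_hd[OF bl]
  let ?h = "hd (D @ [labs x])"
  \<comment> \<open>\<open>V\<close> is the longest final run of plain letters larger than the first
    letter of the block.\<close>
  obtain P V' where PV: "B' = P @ V'" "\<forall>c\<in>set V'. plain c \<and> ?h < labs c"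
      "P \<noteq> [] \<longrightarrow> \<not> (plain (last P) \<and> ?h < labs (last P))"
    using max_suffix_exists[of B' "\<lambda>c. plain c \<and> ?h < labs c"] by blast
  define V where "V = map labs V'"
  have V: "V' = map pl V" using PV map_pl_labs V_def by auto
  have pre: "prebanner l P" "sorted V" "P \<noteq> [] \<Longrightarrow> V \<noteq> [] \<Longrightarrow> letter_ok (last P) (pl (hd V))"
    using B' PV V by (auto simp: good_banner_def banner_iff prebanner_append prebanner_map_pl hd_map)
  have fits: "fits l P D x U V"
    unfolding fits_def
  proof (intro conjI impI)
    show "\<forall>v\<in>set V. ?h < v" using PV(2) V by auto
    assume P: "P \<noteq> []" "lbar (last P)"
    then show V1: "V \<noteq> []" using B' PV V by (auto simp: good_banner_def banner_iff)
    show "hd V \<le> labs (last P)" using pre(3) P V1 by (auto simp: letter_ok_def)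
  qed (use bl pre PV(3) in auto)
  have conds: "prebanner l P \<and> records_ok P \<and> \<not> record_end P \<and> (V \<noteq> [] \<longrightarrow> dominated P (last V))"
    using good_banner_without_block[OF fits] B' PV V by simp
  have "splits l (P @ map br D @ x # map pl (U @ V)) (P @ map pl V) D x U"
    using conds fits False PV(1) V by (intro splits.insert) auto
  then show ?thesis using PV V by auto
qed

text \<open>The letter \<open>x\<close> is the last one that is not plain, \<open>U\<close> is the
  part of the final run up to \<open>labs x\<close>, and \<open>D\<close> is the longest run of
  barred letters before \<open>x\<close> below the first letter of \<open>V\<close>.\<close>

lemma fits_unique:
  assumes f: "fits l P D x U V" "fits l P' D' x' U' V'"
    and eq: "P @ map br D @ x # map pl (U @ V) = P' @ map br D' @ x' # map pl (U' @ V')"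
  shows "P = P' \<and> D = D' \<and> x = x' \<and> U = U' \<and> V = V'"
proof -
  have bl: "block l D x U" "block l D' x' U'" using f by (auto simp: fits_def)
  have np: "\<not> plain x" "\<not> plain x'" using bl by (auto simp: block_def)
  have *: "(P @ map br D @ [x]) @ map pl (U @ V) = (P' @ map br D' @ [x']) @ map pl (U' @ V')"
    using eq by simp
  have Q: "P @ map br D @ [x] = P' @ map br D' @ [x']" and W: "map pl (U @ V) = map pl (U' @ V')"
    by (rule max_suffix_unique[OF *, of plain]; use np in auto)+
  have x: "x = x'" and PD: "P @ map br D = P' @ map br D'" using Q by auto
  have W': "U @ V = U' @ V'" using W by (metis inj_map_eq_map inj_def letter_inject(1))
  have tw: "takeWhile (\<lambda>u. u \<le> labs x) (U @ V) = U" if "fits l P D x U V" for P D U V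
  proof -
    have b: "block l D x U" using that by (simp add: fits_def)
    have "\<forall>v\<in>set V. labs x < v" using that block_hd(1)[OF b] by (auto simp: fits_def)
    then show ?thesis using block_hd(4)[OF b] by (cases V) (auto simp: takeWhile_append)
  qed
  have UV: "U = U'" "V = V'" using tw[OF f(1)] tw[of P' D' U' V'] f(2) x W' by auto
  have *: "\<forall>c\<in>set (map br D). lbar c \<and> (V = [] \<or> labs c < hd V)"
      "P \<noteq> [] \<Longrightarrow> \<not> (lbar (last P) \<and> (V = [] \<or> labs (last P) < hd V))"
    if "fits l P D x U V" for P D
  proof -
    have b: "block l D x U" using that by (simp add: fits_def)
    show "\<forall>c\<in>set (map br D). lbar c \<and> (V = [] \<or> labs c < hd V)"
    proof (cases "V = []")
      case False
      then have "hd (D @ [labs x]) < hd V" using that by (simp add: fits_def)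
      then show ?thesis using block_hd(7)[OF b] le_less_trans by auto
    qed simp
    show "\<not> (lbar (last P) \<and> (V = [] \<or> labs (last P) < hd V))" if "P \<noteq> []"
      using \<open>fits l P D x U V\<close> that by (auto simp: fits_def)
  qed
  have "P = P'" "map br D = map br D'"
    using max_suffix_unique[OF PD, of "\<lambda>c. lbar c \<and> (V = [] \<or> labs c < hd V)"]
      *[of P D] *[of P' D'] f x UV by auto
  then show ?thesis using x UV by (metis inj_map_eq_map inj_def letter_inject(2))
qed

lemma append_const_unique:
  assumes "P @ map pl S = P' @ map pl S'" "S \<noteq> []" "S' \<noteq> []"
    "\<forall>s\<in>set S. s = a" "\<forall>s\<in>set S'. s = a'"
    "good_banner l P" "\<not> dominated P a" "good_banner l P'" "\<not> dominated P' a'"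
  shows "P = P' \<and> S = S'"
proof -
  have "last (map pl S) = last (map pl S')" using assms(1-3)
    by (metis last_appendR map_is_Nil_conv)
  then have "last S = last S'" using assms(2,3) by (simp add: last_map)
  then have a: "a = a'" using assms(2-5) last_const by metis
  have "P = P'" "map pl S = map pl S'"
    by (rule max_suffix_unique[OF assms(1), of "\<lambda>c. c = pl a"];
        use assms a last_ne_record in auto)+
  then show ?thesis by (metis inj_map_eq_map inj_def letter_inject(1))
qed

text \<open>Up to the copies of \<open>a\<close>, both rules cut the word at the same place by
  \<open>fits_unique\<close>. They exclude each other since the resulting prefix ends in a record
  only for \<open>new_record\<close>.\<close>

lemma splits_functional:
  assumes "splits l B B1 D1 x1 U1" "splits l B B2 D2 x2 U2"
  shows "B1 = B2 \<and> D1 = D2 \<and> x1 = x2 \<and> U1 = U2"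
  using assms(1)
proof cases
  case 1: (insert P1 V1)
  from assms(2) show ?thesis
  proof cases
    case 2: (insert P2 V2)
    then show ?thesis using fits_unique[OF 1(3) 2(3)] 1 by simp
  next
    case 2: (new_record U2' S2 a2)
    have "fits l (B2 @ map pl S2) [] x2 U2' []" using fits_record 2 by blast
    then have "P1 = B2 @ map pl S2" using fits_unique[OF 1(3)] 1 2 by auto
    then show ?thesis using 1 2 record_end_append_const by metis
  qed
next
  case 1: (new_record U1' S1 a1)
  have f1: "fits l (B1 @ map pl S1) [] x1 U1' []" using fits_record 1 by blast
  from assms(2) show ?thesis
  proof cases
    case 2: (insert P2 V2)
    then have "P2 = B1 @ map pl S1" using fits_unique[OF f1 2(3)] 1 by auto
    then show ?thesis using 1 2 record_end_append_const by metis
  next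
    case 2: (new_record U2' S2 a2)
    have f2: "fits l (B2 @ map pl S2) [] x2 U2' []" using fits_record 2 by blast
    have *: "B1 @ map pl S1 = B2 @ map pl S2 \<and> x1 = x2 \<and> U1' = U2'"
      using fits_unique[OF f1 f2] 1(1) 2(1) by simp
    then have "B1 = B2 \<and> S1 = S2"
      using append_const_unique[of B1 S1 B2 S2 a1 a2 l] 1 2 by blast
    then show ?thesis using * 1 2 by simp
  qed
qed

text \<open>Seen from \<open>B'\<close>, the rules are separated by domination of the last letter of
  \<open>U\<close>: \<open>ins\<close> gives it for \<open>insert\<close>, \<open>rec\<close>
  refutes it for \<open>new_record\<close>.\<close>

lemma splits_injective:
  assumes "splits l B1 B' D x U" "splits l B2 B' D x U"
  shows "B1 = B2"
proof -
  have ins: "dominated B' (last U)"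
    if "fits l P D x U V" "B' = P @ map pl V" "V \<noteq> [] \<longrightarrow> dominated P (last V)"
      "V = [] \<and> U \<noteq> [] \<and> D = [] \<and> \<not> lbar x \<longrightarrow> dominated P (last U)"
      "U \<noteq> []" "D = []" "\<not> lbar x" for P V
  proof (cases "V = []")
    case True
    then show ?thesis using that by simp
  next
    case False
    have b: "block l D x U" using that by (simp add: fits_def)
    have "last U \<le> hd (D @ [labs x])" "hd (D @ [labs x]) < last V"
      using block_hd(5)[OF b] that False by (auto simp: fits_def simp del: append.simps)
    then show ?thesis using that(2,3) False dominated_mono[of P "last V" "last U"] by simp
  qed
  have rec: "\<not> dominated B' (last U)" if "S \<noteq> []" "\<forall>s\<in>set S. s = a" "\<not> dominated B' a" "U = U' @ S"
    for S a U'
    using that(3) last_const[OF that(1,2)] that(1,4) by simp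
  show ?thesis using assms(1)
  proof cases
    case 1: (insert P1 V1)
    from assms(2) show ?thesis
    proof cases
      case 2: (insert P2 V2)
      \<comment> \<open>The block alone determines where \<open>B'\<close> is cut into
        \<open>P\<close> and \<open>V\<close>.\<close>
      let ?p = "\<lambda>c. plain c \<and> hd (D @ [labs x]) < labs c"
      have eq: "P1 @ map pl V1 = P2 @ map pl V2" using 1 2 by simp
      have "P1 = P2" "map pl V1 = map pl V2"
        by (rule max_suffix_unique[OF eq, of ?p]; use 1(3) 2(3) in \<open>auto simp: fits_def\<close>)+
      then show ?thesis using 1 2 by simp
    next
      case 2: (new_record U2' S2 a2)
      then show ?thesis using rec[of S2 a2 U2'] ins[of P1 V1] 1 by auto
    qed
  next
    case 1: (new_record U1' S1 a1)
    from assms(2) show ?thesis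
    proof cases
      case 2: (insert P2 V2)
      then show ?thesis using rec[of S1 a1 U1'] ins[of P2 V2] 1 by auto
    next
      case 2: (new_record U2' S2 a2)
      have eq: "U1' @ S1 = U2' @ S2" using 1 2 by simp
      have "last S1 = last S2" using eq 1 2 by (metis last_appendR)
      then have a: "a1 = a2" using 1(6,7) 2(6,7) last_const by metis
      have "U1' = U2'" "S1 = S2"
        by (rule max_suffix_unique[OF eq, of "\<lambda>s. s = a1"]; use 1 2 a in auto)+
      then show ?thesis using 1 2 by simp
    qed
  qed
qed

section \<open>The bijection\<close>

text \<open>By \<open>singleton_factor_iff\<close> a bad factor is a weak record before a larger
  letter or the end. In a banner a barred letter is not last and is not followed by a larger letter,
  so only plain records remain.\<close>

lemma no_singleton_factor_iff:
  assumes "banner l B"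
  shows "(\<forall>f\<in>set (lyndon_fact B). \<not> (\<exists>c. f = [c] \<and> lcol c = 0)) \<longleftrightarrow> good B"
proof -
  let ?rec = "\<lambda>c. \<exists>P Q. B = P @ c # Q \<and> (\<forall>d\<in>set P. \<not> lessB c d) \<and> (Q = [] \<or> lessB c (hd Q))"
  have "is_lyndon_fact B (lyndon_fact B)"
    using assms by (intro is_lyndon_fact_lyndon_fact[of _ l]) (simp add: banner_def)
  then have fact: "[c] \<in> set (lyndon_fact B) \<longleftrightarrow> ?rec c" for c
    by (rule singleton_factor_iff)
  have "\<not> good B" if c: "?rec c" "lcol c = 0" for c
  proof -
    obtain P Q where B: "B = P @ c # Q" and P: "\<forall>d\<in>set P. \<not> lessB c d"
      and Q: "Q = [] \<or> lessB c (hd Q)" using c(1) by blast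
    have "\<not> lbar c"
    proof
      assume "lbar c"
      then have "Q \<noteq> []" "letter_ok c (hd Q)"
        using assms B by (auto simp: banner_iff prebanner_append prebanner_Cons)
      then have "labs (hd Q) \<le> labs c" "lessB c (hd Q)"
        using \<open>lbar c\<close> Q by (auto simp: letter_ok_def)
      then show False using \<open>lbar c\<close> c(2) by (auto simp: lessB_def split: if_splits)
    qed
    then obtain u where u: "c = pl u" using c(2) plain_eq[of c] unfolding plain_def by blast
    then have rec: "record_end (P @ [c])" using P by (simp add: dominated_def)
    show ?thesis
    proof (cases Q)
      case Nil
      then show ?thesis using rec B by (simp add: good_def)
    next
      case (Cons d Q')
      then show ?thesis
        using rec B Q records_ok_no_rise[of "P @ [c]" d Q'] by (auto simp: good_def)
    qed
  qed
  moreover have "\<exists>c. ?rec c \<and> lcol c = 0" if "\<not> good B"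
  proof (cases "record_end B")
    case True
    then obtain P u where "B = P @ [pl u]" "\<not> dominated P u" by (auto simp: record_end_def)
    then have "?rec (pl u)" by (auto simp: dominated_def)
    then show ?thesis by (metis letter_simps(2))
  next
    case False
    then obtain P c Q where B: "B = P @ c # Q" "record_end P" "lessB (last P) c"
      using \<open>\<not> good B\<close> by (auto simp: good_def records_ok_def)
    then obtain P' u where P: "P = P' @ [pl u]" "\<not> dominated P' u" by (auto simp: record_end_def)
    then have "B = P' @ pl u # c # Q" "\<forall>d\<in>set P'. \<not> lessB (pl u) d" "lessB (pl u) c"
      using B by (auto simp: dominated_def)
    then have "?rec (pl u)" by (metis list.sel(1))
    then show ?thesis by (metis letter_simps(2))
  qed
  ultimately show ?thesis using fact by blast
qed

lemma K0_iff:
  "B \<in> K0 l n j \<beta> \<longleftrightarrow>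
     good_banner l B \<and> length B = n \<and> col_vec l B = \<beta> \<and> length (filter lbar B) = j"
  using no_singleton_factor_iff by (auto simp: K0_def good_banner_def)

section \<open>Blocks as marked sequences\<close>

definition mark :: "nat list \<Rightarrow> letter \<Rightarrow> nat list \<Rightarrow> nat list \<times> nat \<times> nat" where
  "mark D x U = (U @ labs x # rev D, length D + (if lbar x then 1 else 0), lcol x)"

lemma block_lbar_iff: "block l D x U \<Longrightarrow> lbar x \<longleftrightarrow> lcol x = 0"
  by (auto simp: block_def plain_def valid_letter_def)

text \<open>In a block the colour of \<open>x\<close> decides whether it is barred; the mark then
  gives the length of \<open>D\<close>, which cuts the sequence.\<close>

lemma mark_inject:
  assumes "block l D x U" "block l D' x' U'" "mark D x U = mark D' x' U'"
  shows "D = D' \<and> x = x' \<and> U = U'"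
proof -
  have "lcol x = lcol x'" using assms(3) by (simp add: mark_def)
  then have lb: "lbar x = lbar x'" using assms(1,2) block_lbar_iff by metis
  then have "length D = length D'" using assms(3) by (simp add: mark_def)
  then have "U = U' \<and> labs x # rev D = labs x' # rev D'"
    using assms(3) append_eq_append_conv[of "labs x # rev D" "labs x' # rev D'" U U']
    by (auto simp: mark_def)
  moreover have "x = x'" if "labs x = labs x'"
    using that lb \<open>lcol x = lcol x'\<close> by (simp add: labs_def lcol_def lbar_def prod_eq_iff)
  ultimately show ?thesis by simp
qed

lemma mark_in_Mseq:
  assumes "block l D x U" "mark D x U = (\<omega>, b, m)"
  shows "\<omega> \<in> Mseq l (length \<omega>) b m" "m < l"
proof -
  have "b < length \<omega>" using assms by (auto simp: mark_def block_def)
  moreover have "m = 0 \<Longrightarrow> 1 \<le> b" "m < l" "sorted \<omega>" "\<forall>w\<in>set \<omega>. 1 \<le> w"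
    using assms block_lbar_iff[OF assms(1)]
    by (auto simp: mark_def block_def valid_letter_def)
  ultimately show "\<omega> \<in> Mseq l (length \<omega>) b m" "m < l" by (auto simp: Mseq_def)
qed

lemma mark_onto:
  assumes "\<omega> \<in> Mseq l (length \<omega>) b m" "1 \<le> l"
  shows "\<exists>D x U. block l D x U \<and> mark D x U = (\<omega>, b, m)"
proof -
  have \<omega>: "sorted \<omega>" "\<forall>w\<in>set \<omega>. 1 \<le> w" "b < length \<omega>" "m = 0 \<longrightarrow> 1 \<le> b" "m < l"
    using assms by (auto simp: Mseq_def split: if_splits)
  \<comment> \<open>The length of \<open>D\<close>: for colour 0 one of the \<open>b\<close> barred
    letters is \<open>x\<close> itself.\<close>
  define d where "d = (if m = 0 then b - 1 else b)"
  \<comment> \<open>The position of \<open>labs x\<close>; it is positive for colour 0 because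
    \<open>b < length \<omega>\<close>, so \<open>U\<close> is nonempty there.\<close>
  define k where "k = length \<omega> - Suc d"
  define U where "U = take k \<omega>"
  define D where "D = rev (drop (Suc k) \<omega>)"
  define x where "x = (\<omega> ! k, m, m = 0)"
  have len: "d < length \<omega>" "k < length \<omega>" "length D = d" "m = 0 \<Longrightarrow> 0 < k"
    using \<omega>(3,4) by (auto simp: d_def k_def D_def)
  have eq: "\<omega> = U @ labs x # rev D"
    using id_take_nth_drop[OF len(2)] by (simp add: U_def D_def x_def)
  have "mark D x U = (\<omega>, b, m)"
    using eq len(3) \<omega>(4) by (auto simp: mark_def x_def d_def)
  moreover have "sorted (U @ labs x # rev D)"
    using \<omega>(1) eq by metis
  moreover have "set \<omega> = set U \<union> {labs x} \<union> set D"
    by (subst eq) simp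
  ultimately have "mark D x U = (\<omega>, b, m)" "block l D x U"
    using \<omega>(2,5) len by (auto simp: block_def valid_letter_def plain_def x_def U_def)
  then show ?thesis by blast
qed

lemma length_filter_cong_mset: "mset xs = mset ys \<Longrightarrow> length (filter p xs) = length (filter p ys)"
  by (metis mset_filter size_mset)

text \<open>All these statistics depend only on the multiset of letters, so
  \<open>splits_mset\<close> treats both rules at once.\<close>

lemma splits_stats:
  assumes "splits l B B' D x U" "mark D x U = (\<omega>, b, m)"
  shows "wtB B = wtB B' + wt_seq \<omega>" "length B = length B' + length \<omega>"
    "length (filter lbar B) = length (filter lbar B') + b"
    "col_vec l B i = col_vec l B' i + (if i = m \<and> 1 \<le> m then 1 else 0)"
proof -
  note ms = splits_mset[OF assms(1)]
  have bl: "block l D x U" using assms splits_target by blast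
  have \<omega>: "\<omega> = U @ labs x # rev D" "b = length D + (if lbar x then 1 else 0)" "m = lcol x"
    using assms(2) by (simp_all add: mark_def)
  have "wtB B = image_mset labs (mset B)" by (simp add: wtB_def)
  also have "\<dots> = wtB B' + wt_seq \<omega>"
    unfolding ms \<omega> by (simp add: wtB_def wt_seq_def multiset.map_comp comp_def)
  finally show "wtB B = wtB B' + wt_seq \<omega>" .
  show "length B = length B' + length \<omega>"
    using mset_eq_length[OF ms] unfolding \<omega> by simp
  have filt: "length (filter p B) = length (filter p B') + length (filter p (map br D)) +
      (if p x then 1 else 0) + length (filter p (map pl U))" for p
    using length_filter_cong_mset[OF ms, of p] by (simp del: filter_map)
  show "length (filter lbar B) = length (filter lbar B') + b"
    unfolding \<omega> filt by (simp add: filter_map comp_def)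
  show "col_vec l B i = col_vec l B' i + (if i = m \<and> 1 \<le> m then 1 else 0)"
    using bl unfolding \<omega> col_vec_def filt
    by (auto simp: filter_map comp_def block_def valid_letter_def)
qed

text \<open>The bounds on \<open>i\<close> and \<open>k\<close> say exactly that the mark is
  admissible for the given length. The additive form avoids truncated subtraction and also covers
  \<open>\<beta> m = 0\<close>, where its colour equation fails.\<close>

lemma Xset_iff:
  assumes "1 \<le> l" "1 \<le> n"
  shows "(B', \<omega>, b, m) \<in> (\<Union>m\<in>{0..<l}. Xset l n j \<beta> m) \<longleftrightarrow>
    good_banner l B' \<and> length B' + length \<omega> = n \<and> length (filter lbar B') + b = j \<and>
    (\<forall>i. col_vec l B' i + (if i = m \<and> 1 \<le> m then 1 else 0) = \<beta> i) \<and>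
    \<omega> \<in> Mseq l (length \<omega>) b m" (is "?L \<longleftrightarrow> ?R")
proof -
  have "?L \<longleftrightarrow> m < l \<and> (B', \<omega>, b, m) \<in> Xset l n j \<beta> m"
    by (auto simp: Xset_def split: if_splits)
  also have "\<dots> \<longleftrightarrow> ?R"
  proof (cases "m = 0")
    case True
    then show ?thesis
      using assms by (auto simp: Xset_def K0_iff Mseq_def fun_eq_iff split: if_splits)
  next
    case False
    then show ?thesis
      using assms
      by (auto simp: Xset_def K0_iff Mseq_def fun_eq_iff beta_hat_def split: if_splits)
  qed
  finally show ?thesis .
qed

section \<open>From the splitting relation to the bijection\<close>

lemma bij_betw_of_relation:
  assumes "\<And>a. a \<in> A \<Longrightarrow> \<exists>b\<in>B. R a b" "\<And>b. b \<in> B \<Longrightarrow> \<exists>a\<in>A. R a b"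
    and "\<And>a b b'. R a b \<Longrightarrow> R a b' \<Longrightarrow> b = b'" "\<And>a a' b. R a b \<Longrightarrow> R a' b \<Longrightarrow> a = a'"
  shows "\<exists>f. bij_betw f A B \<and> (\<forall>a\<in>A. R a (f a))"
proof -
  obtain f where f: "\<forall>a\<in>A. f a \<in> B \<and> R a (f a)" using assms(1) by metis
  have "inj_on f A"
  proof (rule inj_onI)
    fix a a' assume "a \<in> A" "a' \<in> A" "f a = f a'"
    then have "R a (f a)" "R a' (f a)" using f by auto
    then show "a = a'" by (rule assms(4))
  qed
  moreover have "f ` A = B"
  proof
    show "f ` A \<subseteq> B" using f by auto
    show "B \<subseteq> f ` A"
    proof
      fix b assume "b \<in> B"
      then obtain a where "a \<in> A" "R a b" using assms(2) by blast
      moreover from this have "b = f a" using f assms(3) by blast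
      ultimately show "b \<in> f ` A" by simp
    qed
  qed
  ultimately show ?thesis using f by (auto simp: bij_betw_def)
qed

theorem theorem4p15:
  fixes l n j :: nat and \<beta> :: "nat \<Rightarrow> nat"
  assumes "l \<ge> 1" and "n \<ge> 1"
    and "\<forall>m. \<beta> m \<noteq> 0 \<longrightarrow> 1 \<le> m \<and> m < l"
  shows "\<exists>\<Upsilon>. bij_betw \<Upsilon> (K0 l n j \<beta>) (\<Union>m\<in>{0..<l}. Xset l n j \<beta> m) \<and>
           (\<forall>B\<in>K0 l n j \<beta>. \<forall>B' \<omega> b m. \<Upsilon> B = (B', (\<omega>, b, m)) \<longrightarrow>
              wtB B = wtB B' + wt_seq \<omega> \<and>
              col_vec l B' = (if m \<ge> 1 then beta_hat \<beta> m else \<beta>))"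
proof -
  let ?X = "\<Union>m\<in>{0..<l}. Xset l n j \<beta> m"
  define R where "R B t \<longleftrightarrow> (\<exists>B' D x U. splits l B B' D x U \<and> t = (B', mark D x U))" for B t
  \<comment> \<open>Related objects satisfy the two membership conditions simultaneously, so
    totality and surjectivity of \<open>splits\<close> on all good banners restrict to the given
    \<open>n\<close>, \<open>j\<close> and \<open>\<beta>\<close>.\<close>
  have mem: "B \<in> K0 l n j \<beta> \<longleftrightarrow> t \<in> ?X" if "R B t" for B t
  proof -
    obtain B' D x U \<omega> b m where s: "splits l B B' D x U" and t: "t = (B', \<omega>, b, m)"
      and m: "mark D x U = (\<omega>, b, m)"
      using \<open>R B t\<close> unfolding R_def by (metis prod_cases3)
    show ?thesis
      unfolding t Xset_iff[OF assms(1,2)] K0_iff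
      using splits_stats[OF s m] splits_good_banner[OF s] splits_target[OF s]
        mark_in_Mseq[OF _ m] by (auto simp: fun_eq_iff)
  qed
  have "\<exists>t\<in>?X. R B t" if "B \<in> K0 l n j \<beta>" for B
  proof -
    have "good_banner l B" "B \<noteq> []" using that assms(2) by (auto simp: K0_iff)
    then obtain t where "R B t" using splits_total unfolding R_def by metis
    then show ?thesis using mem that by blast
  qed
  moreover have "\<exists>B\<in>K0 l n j \<beta>. R B t" if "t \<in> ?X" for t
  proof -
    obtain B' \<omega> b m where t: "t = (B', \<omega>, b, m)" by (metis prod_cases4)
    then have "good_banner l B'" "\<omega> \<in> Mseq l (length \<omega>) b m"
      using that Xset_iff[OF assms(1,2)] by auto
    then obtain B where "R B t"
      using t mark_onto[OF _ assms(1)] splits_onto unfolding R_def by metis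
    then show ?thesis using mem that by blast
  qed
  moreover have "t = t'" if "R B t" "R B t'" for B t t'
    using that splits_functional unfolding R_def by metis
  moreover have "B1 = B2" if "R B1 t" "R B2 t" for B1 B2 t
    using that splits_injective mark_inject splits_target(2) unfolding R_def by (metis prod.inject)
  ultimately have "\<exists>\<Upsilon>. bij_betw \<Upsilon> (K0 l n j \<beta>) ?X \<and> (\<forall>B\<in>K0 l n j \<beta>. R B (\<Upsilon> B))"
    by (rule bij_betw_of_relation)
  then obtain \<Upsilon> where bij: "bij_betw \<Upsilon> (K0 l n j \<beta>) ?X" and R: "\<forall>B\<in>K0 l n j \<beta>. R B (\<Upsilon> B)"
    by blast
  have "wtB B = wtB B' + wt_seq \<omega> \<and> col_vec l B' = (if m \<ge> 1 then beta_hat \<beta> m else \<beta>)"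
    if B: "B \<in> K0 l n j \<beta>" and t: "\<Upsilon> B = (B', \<omega>, b, m)" for B B' \<omega> b m
  proof -
    obtain D x U where s: "splits l B B' D x U" and m: "mark D x U = (\<omega>, b, m)"
      using R B t unfolding R_def by (metis prod.inject)
    have "col_vec l B = \<beta>" using B by (simp add: K0_iff)
    then have \<beta>: "col_vec l B' i + (if i = m \<and> 1 \<le> m then 1 else 0) = \<beta> i" for i
      using splits_stats(4)[OF s m, of i] by simp
    have "col_vec l B' = (if m \<ge> 1 then beta_hat \<beta> m else \<beta>)"
    proof
      fix i
      show "col_vec l B' i = (if m \<ge> 1 then beta_hat \<beta> m else \<beta>) i"
        using \<beta>[of i] by (auto simp: beta_hat_def split: if_splits)
    qed
    then show ?thesis using splits_stats(1)[OF s m] by simp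
  qed
  then show ?thesis using bij by blast
qed

end
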